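(* Let $\mathbb C$ be any VC class. Then Meta-Algorithm 0 is a universal activizer for $\mathbb C$ if and only if every $f\in\mathbb C$ and every distribution $\mathcal P$ on $\mathcal X$ satisfy $\mathcal P(\partial_{\mathbb C,\mathcal P} f)=0$.
   Context: Setting. $(\mathcal X,\mathcal F)$ is a standard Borel space; a classifier is a measurable $h:\mathcal X\to\{-1,+1\}$; a concept space $\mathbb C$ is a set of classifiers; a VC class is a concept space whose VC dimension $d$ satisfies $0<d<\infty$. All sets arising are implicitly assumed measurable. For a probability measure ("distribution") $\mathcal P$ on $\mathcal X$ and a target function $f\in\mathbb C$: $X_1,X_2,\ldots$ are i.i.d. $\mathcal P$, $Y_i=f(X_i)$, $\mathcal Z_m=((X_1,Y_1),\ldots,(X_m,Y_m))$, and $\mathrm{er}(h)=\mathcal P(x:h(x)\ne f(x))$. A passive learning algorithm is a (possibly randomized) map $\mathcal A$ from finite sequences $\mathcal L\in\bigcup_n(\mathcal X\times\{-1,+1\})^n$ to classifiers. An active learning algorithm (possibly randomized) gets a label budget $n\in\mathbb N$ and access to $X_1,X_2,\ldots$; it sequentially requests labels $Y_i$ of indices of its choice (choices may depend on labels already seen), at most $n$ in total, and returns a classifier $\mathcal A(n)$. A passive (resp. active) algorithm achieves label complexity $\Lambda$ if for every $f\in\mathbb C$, distribution $\mathcal P$, $\varepsilon\in(0,1)$ and integer $n\ge\Lambda(\varepsilon,f,\mathcal P)$, $\mathbb E[\mathrm{er}(\mathcal A(\mathcal Z_n))]\le\varepsilon$ (resp. $\mathbb E[\mathrm{er}(\mathcal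 A(n))]\le\varepsilon$). Label complexities take values in $\{1,2,\ldots\}\cup\{\infty\}$. Asymptotic notation is as $\varepsilon\to0^+$. Activizers. $\mathrm{Polylog}(1/\varepsilon)$ is the class of $g:(0,1)\to[0,\infty)$ with $g(\varepsilon)=O(\log^k(1/\varepsilon))$ for some $k\in[0,\infty)$. $\mathrm{Nontrivial}(\Lambda)$ is the set of pairs $(f,\mathcal P)$ with $\Lambda(\varepsilon,f,\mathcal P)<\infty$ for all $\varepsilon>0$ and $\Lambda(\varepsilon,f,\mathcal P)=\omega(g(\varepsilon))$ for all $g\in\mathrm{Polylog}(1/\varepsilon)$. An active meta-algorithm $\mathcal A_a$ takes a passive algorithm $\mathcal A_p$ and a budget $n$, and $\mathcal A_a(\mathcal A_p,\cdot)$ is an active learning algorithm for every $\mathcal A_p$. $\mathcal A_a$ activizes $\mathcal A_p$ for $\mathbb C$ if for any label complexity $\Lambda_p$ achieved by $\mathcal A_p$, $\mathcal A_a(\mathcal A_p,\cdot)$ achieves a label complexity $\Lambda_a$ such that for every $f\in\mathbb C$ and every distribution $\mathcal P$ with $(f,\mathcal P)\in\mathrm{Nontrivial}(\Lambda_p)$ there is a constant $c\in[1,\infty)$ with $\Lambda_a(c\varepsilon,f,\mathcal P)=o(\Lambda_p(\varepsilon,f,\mathcal P))$. $\mathcal A_a$ is a universal activizer for $\mathbb C$ if it activizes every passive learning algorithm for $\mathbb C$. Disagreement core. For a set $\mathcal H$ of classifiers, $\mathrm{DIS}(\mathcal H)=\{x\in\mathcal X:\exists h_1,h_2\in\mathcal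 H,\ h_1(x)\ne h_2(x)\}$; $\mathrm B_{\mathcal H,\mathcal P}(f,r)=\{g\in\mathcal H:\mathcal P(x:g(x)\ne f(x))\le r\}$; $\partial_{\mathcal H,\mathcal P}f=\lim_{r\to0^+}\mathrm{DIS}(\mathrm B_{\mathcal H,\mathcal P}(f,r))$ (a decreasing limit, i.e. the intersection over $r>0$). Meta-Algorithm 0 (input: passive algorithm $\mathcal A_p$, budget $n$). 0. Request the labels $Y_1,\ldots,Y_{\lfloor n/2\rfloor}$; $t\gets\lfloor n/2\rfloor$. 1. $V=\{h\in\mathbb C: h(X_i)=Y_i\ \forall i\le\lfloor n/2\rfloor\}$. 2. $\hat\Delta\gets\hat P_n(\mathrm{DIS}(V))=\max\{\frac{2}{n^2}\sum_{i=n^2+1}^{2n^2}\mathbb 1[X_i\in\mathrm{DIS}(V)],\ \frac4n\}$. 3. $\mathcal L\gets()$ (empty). 4. For $m=\lfloor n/2\rfloor+1,\ldots,\lfloor n/2\rfloor+\lfloor n/(4\hat\Delta)\rfloor$: 5. if $X_m\in\mathrm{DIS}(V)$ and $t<n$, request $Y_m$, let $\hat y\gets Y_m$, $t\gets t+1$; 6. else let $\hat y\gets h(X_m)$ for an arbitrary $h\in V$; 7. append $(X_m,\hat y)$ to $\mathcal L$. 8. Return $\mathcal A_p(\mathcal L)$. *)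

theory Defs
  imports "HOL-Probability.Probability"
begin

text \<open>
  The instance space is a Polish space with its Borel sets, i.e. a standard Borel space.
  Labels are Booleans: \<open>True\<close> stands for +1 and \<open>False\<close> for -1 (labels are only ever compared).
  Data sequences are indexed from 0: \<open>x 0\<close> is the first data point.
\<close>

type_synonym 'a classifier = "'a \<Rightarrow> bool"
type_synonym 'a sample = "('a \<times> bool) list"

definition distribution :: "'a::topological_space measure \<Rightarrow> bool" where
  "distribution P \<longleftrightarrow> prob_space P \<and> sets P = sets borel"

definition shatters :: "'a classifier set \<Rightarrow> 'a set \<Rightarrow> bool" where
  "shatters C S \<longleftrightarrow> (\<forall>T\<subseteq>S. \<exists>h\<in>C. \<forall>x\<in>S. h x \<longleftrightarrow> x \<in> T)"

definition vc_dim :: "'a classifier set \<Rightarrow> enat" where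
  "vc_dim C = (SUP S\<in>{S. finite S \<and> shatters C S}. enat (card S))"

definition vc_class :: "'a::topological_space classifier set \<Rightarrow> bool" where
  "vc_class C \<longleftrightarrow> (\<forall>h\<in>C. h \<in> borel \<rightarrow>\<^sub>M count_space UNIV) \<and> 0 < vc_dim C \<and> vc_dim C < \<infinity>"

definition er :: "'a measure \<Rightarrow> 'a classifier \<Rightarrow> 'a classifier \<Rightarrow> real" where
  "er P f h = measure P {x. h x \<noteq> f x}"

definition DIS :: "'a classifier set \<Rightarrow> 'a set" where
  "DIS H = {x. \<exists>h1\<in>H. \<exists>h2\<in>H. h1 x \<noteq> h2 x}"

definition concept_ball :: "'a classifier set \<Rightarrow> 'a measure \<Rightarrow> 'a classifier \<Rightarrow> real \<Rightarrow> 'a classifier set" where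
  "concept_ball H P f r = {g \<in> H. measure P {x. g x \<noteq> f x} \<le> r}"

definition disagreement_core :: "'a classifier set \<Rightarrow> 'a measure \<Rightarrow> 'a classifier \<Rightarrow> 'a set" where
  "disagreement_core H P f = (\<Inter>r\<in>{0<..}. DIS (concept_ball H P f r))"

definition version_space :: "'a classifier set \<Rightarrow> 'a sample \<Rightarrow> 'a classifier set" where
  "version_space C S = {h \<in> C. \<forall>(x, y)\<in>set S. h x = y}"

text \<open>
  The standing assumption that all sets arising are measurable, made explicit: the sets of point
  tuples on which a given label pattern is realized by \<open>C\<close> (these generate the regions of
  disagreement of version spaces, and the events of the uniform convergence bounds for VC classes),
  and the regions of disagreement of balls in \<open>C\<close>.
\<close>
definition measurable_class :: "'a::topological_space classifier set \<Rightarrow> bool" where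
  "measurable_class C \<longleftrightarrow>
     (\<forall>m (y :: nat \<Rightarrow> bool).
        {x. \<exists>h\<in>C. \<forall>i<m. h (x i) = y i} \<in> sets (PiM UNIV (\<lambda>_::nat. borel))) \<and>
     (\<forall>f\<in>C. \<forall>P. \<forall>r>0. distribution P \<longrightarrow> DIS (concept_ball C P f r) \<in> sets borel)"


subsection \<open>Passive and active learning algorithms\<close>

text \<open>
  Randomized algorithms receive a random seed, uniform on \<open>[0,1]\<close> and independent of the data.
\<close>

definition seed :: "real measure" where
  "seed = uniform_measure lborel {0..1}"

type_synonym 'a passive_map = "real \<Rightarrow> 'a sample \<Rightarrow> 'a classifier"

definition passive_algorithm :: "'a::topological_space passive_map \<Rightarrow> bool" where
  "passive_algorithm A \<longleftrightarrow>
     (\<forall>m. (\<lambda>(u, z, x). A u (map z [0..<m]) x)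
        \<in> borel \<Otimes>\<^sub>M PiM UNIV (\<lambda>_::nat. borel \<Otimes>\<^sub>M count_space UNIV) \<Otimes>\<^sub>M borel
          \<rightarrow>\<^sub>M count_space UNIV)"

text \<open>
  A sequential label-requesting strategy: either return a result, or request the label with a
  given index and continue depending on the answer.
\<close>
datatype 'r strategy = Return 'r | Request nat "bool \<Rightarrow> 'r strategy"

primrec run :: "(nat \<Rightarrow> bool) \<Rightarrow> 'r strategy \<Rightarrow> 'r" where
  "run y (Return r) = r"
| "run y (Request i k) = run y (k (y i))"

primrec requests :: "(nat \<Rightarrow> bool) \<Rightarrow> 'r strategy \<Rightarrow> nat" where
  "requests y (Return r) = 0"
| "requests y (Request i k) = Suc (requests y (k (y i)))"

text \<open>Arguments: label budget, random seed, unlabeled data sequence.\<close>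
type_synonym 'a active_map = "nat \<Rightarrow> real \<Rightarrow> (nat \<Rightarrow> 'a) \<Rightarrow> 'a classifier strategy"

definition active_algorithm :: "'a::topological_space active_map \<Rightarrow> bool" where
  "active_algorithm A \<longleftrightarrow>
     (\<forall>n u x y. requests y (A n u x) \<le> n) \<and>
     (\<forall>n. (\<lambda>(u, x, y, z). run y (A n u x) z)
        \<in> borel \<Otimes>\<^sub>M PiM UNIV (\<lambda>_::nat. borel) \<Otimes>\<^sub>M PiM UNIV (\<lambda>_::nat. count_space UNIV) \<Otimes>\<^sub>M borel
          \<rightarrow>\<^sub>M count_space UNIV)"

definition passive_risk :: "'a passive_map \<Rightarrow> 'a classifier \<Rightarrow> 'a measure \<Rightarrow> nat \<Rightarrow> real" where
  "passive_risk A f P n =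
     (LINT (u, x)|(seed \<Otimes>\<^sub>M PiM UNIV (\<lambda>_::nat. P)). er P f (A u (map (\<lambda>i. (x i, f (x i))) [0..<n])))"

definition active_risk :: "'a active_map \<Rightarrow> 'a classifier \<Rightarrow> 'a measure \<Rightarrow> nat \<Rightarrow> real" where
  "active_risk A f P n =
     (LINT (u, x)|(seed \<Otimes>\<^sub>M PiM UNIV (\<lambda>_::nat. P)). er P f (run (\<lambda>i. f (x i)) (A n u x)))"

type_synonym 'a label_complexity = "real \<Rightarrow> 'a classifier \<Rightarrow> 'a measure \<Rightarrow> enat"

text \<open>
  \<open>risk f P n\<close> is the expected error rate of the algorithm with \<open>n\<close> labels.
\<close>
definition achieves ::
  "'a::topological_space classifier set \<Rightarrow> ('a classifier \<Rightarrow> 'a measure \<Rightarrow> nat \<Rightarrow> real)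
    \<Rightarrow> 'a label_complexity \<Rightarrow> bool" where
  "achieves C risk \<Lambda> \<longleftrightarrow>
     (\<forall>f\<in>C. \<forall>P \<epsilon>. distribution P \<longrightarrow> \<epsilon> \<in> {0<..<1} \<longrightarrow>
        1 \<le> \<Lambda> \<epsilon> f P \<and> (\<forall>n. \<Lambda> \<epsilon> f P \<le> enat n \<longrightarrow> risk f P n \<le> \<epsilon>))"


subsection \<open>Activizers\<close>

definition polylog :: "(real \<Rightarrow> real) set" where
  "polylog = {g. (\<forall>\<epsilon>\<in>{0<..<1}. 0 \<le> g \<epsilon>) \<and>
                 (\<exists>k\<ge>0. g \<in> O[at_right 0](\<lambda>\<epsilon>. ln (1 / \<epsilon>) powr k))}"

definition nontrivial :: "'a label_complexity \<Rightarrow> ('a classifier \<times> 'a measure) set" where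
  "nontrivial \<Lambda> = {(f, P). (\<forall>\<epsilon>\<in>{0<..<1}. \<Lambda> \<epsilon> f P < \<infinity>) \<and>
     (\<forall>g\<in>polylog. (\<lambda>\<epsilon>. real (the_enat (\<Lambda> \<epsilon> f P))) \<in> \<omega>[at_right 0](g))}"

type_synonym 'a meta_algorithm = "'a passive_map \<Rightarrow> 'a active_map"

definition active_meta_algorithm :: "'a::topological_space meta_algorithm \<Rightarrow> bool" where
  "active_meta_algorithm Aa \<longleftrightarrow> (\<forall>Ap. passive_algorithm Ap \<longrightarrow> active_algorithm (Aa Ap))"

definition activizes ::
  "'a::topological_space meta_algorithm \<Rightarrow> 'a passive_map \<Rightarrow> 'a classifier set \<Rightarrow> bool" where
  "activizes Aa Ap C \<longleftrightarrow>
     (\<forall>\<Lambda>p. achieves C (passive_risk Ap) \<Lambda>p \<longrightarrow>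
        (\<exists>\<Lambda>a. achieves C (active_risk (Aa Ap)) \<Lambda>a \<and>
           (\<forall>f\<in>C. \<forall>P. distribution P \<longrightarrow> (f, P) \<in> nontrivial \<Lambda>p \<longrightarrow>
              (\<exists>c\<ge>1.
                 (\<forall>\<^sub>F \<epsilon> in at_right 0. \<Lambda>a (c * \<epsilon>) f P < \<infinity>) \<and>
                 (\<lambda>\<epsilon>. real (the_enat (\<Lambda>a (c * \<epsilon>) f P)))
                   \<in> o[at_right 0](\<lambda>\<epsilon>. real (the_enat (\<Lambda>p \<epsilon> f P)))))))"

definition universal_activizer ::
  "'a::topological_space meta_algorithm \<Rightarrow> 'a classifier set \<Rightarrow> bool" where
  "universal_activizer Aa C \<longleftrightarrow>
     active_meta_algorithm Aa \<and> (\<forall>Ap. passive_algorithm Ap \<longrightarrow> activizes Aa Ap C)"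


subsection \<open>Meta-Algorithm 0\<close>

text \<open>
  A rule for the arbitrary choice of \<open>h \<in> V\<close> in the labeling loop. The choice may differ between
  iterations: it may depend on the initial labeled sample \<open>S\<close>, on the sample \<open>L\<close> constructed so
  far, and on the current point.
\<close>
type_synonym 'a choice_rule = "'a sample \<Rightarrow> 'a sample \<Rightarrow> 'a \<Rightarrow> 'a classifier"

definition valid_choice_rule :: "'a::topological_space classifier set \<Rightarrow> 'a choice_rule \<Rightarrow> bool" where
  "valid_choice_rule C pick \<longleftrightarrow>
     (\<forall>S L x. version_space C S \<noteq> {} \<longrightarrow> pick S L x \<in> version_space C S) \<and>
     (\<forall>k l. (\<lambda>(s, w, x). pick (map s [0..<k]) (map w [0..<l]) x x)
        \<in> PiM UNIV (\<lambda>_::nat. borel \<Otimes>\<^sub>M count_space UNIV)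
            \<Otimes>\<^sub>M PiM UNIV (\<lambda>_::nat. borel \<Otimes>\<^sub>M count_space UNIV) \<Otimes>\<^sub>M borel
          \<rightarrow>\<^sub>M count_space UNIV)"

primrec request_labels :: "nat list \<Rightarrow> (bool list \<Rightarrow> 'r strategy) \<Rightarrow> 'r strategy" where
  "request_labels [] k = k []"
| "request_labels (i # is) k = Request i (\<lambda>y. request_labels is (\<lambda>ys. k (y # ys)))"

text \<open>
  \<open>label_loop D guess n x ms t L\<close>: the labeling loop over the remaining indices \<open>ms\<close>, where \<open>t\<close> labels
  have been requested so far, \<open>L\<close> is the sample constructed so far, and \<open>D\<close> is \<open>DIS V\<close>.
\<close>
primrec label_loop ::
  "'a set \<Rightarrow> ('a sample \<Rightarrow> 'a \<Rightarrow> 'a classifier) \<Rightarrow> nat \<Rightarrow> (nat \<Rightarrow> 'a) \<Rightarrow> nat list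
    \<Rightarrow> nat \<Rightarrow> 'a sample \<Rightarrow> 'a sample strategy" where
  "label_loop D guess n x [] t L = Return L"
| "label_loop D guess n x (m # ms) t L =
     (if x m \<in> D \<and> t < n
      then Request m (\<lambda>y. label_loop D guess n x ms (Suc t) (L @ [(x m, y)]))
      else label_loop D guess n x ms t (L @ [(x m, guess L (x m) (x m))]))"

definition meta_algorithm_0 ::
  "'a classifier set \<Rightarrow> 'a choice_rule \<Rightarrow> 'a meta_algorithm" where
  "meta_algorithm_0 C pick Ap n u x =
     request_labels [0..<n div 2] (\<lambda>ys.
       let S = zip (map x [0..<n div 2]) ys;
           V = version_space C S;
           \<Delta> = max (2 / (real n)\<^sup>2 * (\<Sum>i\<in>{n\<^sup>2..<2 * n\<^sup>2}. indicator (DIS V) (x i))) (4 / real n);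
           N = nat \<lfloor>real n / (4 * \<Delta>)\<rfloor>
       in map_strategy (Ap u)
            (label_loop (DIS V) (pick S) n x [n div 2..<n div 2 + N] (n div 2) []))"

end

theory Submission
  imports Defs "HOL-Real_Asymp.Real_Asymp"
begin

text \<open>
  If the disagreement core of \<open>f\<close> is null, then the probability of \<open>DIS (concept_ball C P f r)\<close> tends to \<open>0\<close>
  with \<open>r\<close>. By the classical symmetrization argument the version space of \<open>n div 2\<close> labels lies
  in such a ball except with probability exponentially small in \<open>n\<close>, so for every \<open>K\<close> the algorithm
  feeds at least \<open>K * n\<close> correctly labeled points to the passive learner, up to exponentially small
  probability. A target complexity above every multiple of \<open>ln (1/\<epsilon>)\<close> absorbs these failures.

  Conversely, a point of the core belongs to the region of disagreement of the version space almost
  surely, however many labels have been seen. If the core has probability \<open>p > 0\<close>, the passive learner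
  receives a number of examples whose reciprocal has expectation at least \<open>p/n\<close>, and a learner
  whose risk is exactly \<open>1/m\<close> on \<open>m\<close> examples gains no more than a constant factor.
\<close>

subsection \<open>Growth function and swaps\<close>

text \<open>The constants of the algorithm leave a factor of two wherever a random count meets its
  mean. Because of the factor 2 in the estimate, it falls below the probability of
  \<open>DIS V\<close> only if the count is less than half its mean. If it is at least that
  probability, the loop meets \<open>DIS V\<close> at most \<open>n / 4\<close> times on average,
  while exhausting the budget takes about \<open>n / 2\<close> requests. All members of the version
  space agree with \<open>f\<close> outside \<open>DIS V\<close>, so the learner then sees a genuine
  labeled sample.

  The active complexity is compared at \<open>2 * \<epsilon>\<close>: one \<open>\<epsilon>\<close>
  pays for the passive risk, the other for the exponentially small failure term.

  For the converse, nothing is known about the guessed labels once the budget is spent. The bad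
  learner is therefore randomized and reads only the length of its sample, and its risk is exact for
  every length. The reciprocal of the length is at least a multiple of the estimate divided by
  \<open>n\<close>, which reduces the lower bound to the mean probability of
  \<open>DIS V\<close>.\<close>

lemma card_le_card_shattered:
  assumes "finite X" "F \<subseteq> Pow X"
  shows "card F \<le> card {T. T \<subseteq> X \<and> (\<forall>U\<subseteq>T. \<exists>e\<in>F. e \<inter> T = U)}"
  using assms
proof (induction X arbitrary: F rule: finite_induct)
  case empty
  show ?case
  proof (cases "F = {}")
    case False
    then have "F = {{}}" using empty by auto
    moreover have "{T::'a set. T \<subseteq> {} \<and> (\<forall>U\<subseteq>T. \<exists>e\<in>{{}}. e \<inter> T = U)} = {{}}" by auto
    ultimately show ?thesis by simp
  qed simp
next
  case (insert a X)
  let ?Sh = "\<lambda>Y G. {T. T \<subseteq> Y \<and> (\<forall>U\<subseteq>T. \<exists>e\<in>G. e \<inter> T = U)}"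
  \<comment> \<open>The Sauer-Shelah lemma in Pajor's form. Splitting off \<open>a\<close> preserves
    the count, \<open>card F = card A + card B = card (A \<union> B) + card (A \<inter> B)\<close>.
    Sets shattered by \<open>A \<union> B\<close> are shattered by \<open>F\<close>, and those
    shattered by \<open>A \<inter> B\<close> remain so after inserting \<open>a\<close>. The former
    avoid \<open>a\<close> and the latter contain it, so nothing is counted twice.\<close>
  define A where "A = {e \<in> F. a \<notin> e}"
  define B where "B = (\<lambda>e. e - {a}) ` {e \<in> F. a \<in> e}"
  have finF: "finite F" using insert by (auto intro: finite_subset)
  have sub: "A \<union> B \<subseteq> Pow X" using insert unfolding A_def B_def by auto
  have "inj_on (\<lambda>e. e - {a}) {e \<in> F. a \<in> e}"
    by (auto simp: inj_on_def)
  then have "card B = card {e \<in> F. a \<in> e}"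
    unfolding B_def by (rule card_image)
  moreover have "card F = card A + card {e \<in> F. a \<in> e}"
    unfolding A_def using finF
    by (subst card_Un_disjoint[symmetric]) (auto intro!: arg_cong[where f=card])
  moreover have "card A + card B = card (A \<union> B) + card (A \<inter> B)"
    using finF by (intro card_Un_Int) (auto simp: A_def B_def)
  moreover have "card (A \<union> B) \<le> card (?Sh X (A \<union> B))"
    using insert.IH[OF sub] .
  moreover have "card (A \<inter> B) \<le> card (?Sh X (A \<inter> B))"
    using sub by (intro insert.IH) auto
  moreover have "card (?Sh X (A \<union> B)) + card (?Sh X (A \<inter> B)) \<le> card (?Sh (insert a X) F)"
  proof -
    have inj: "inj_on (insert a) (?Sh X (A \<inter> B))"
      by (rule inj_on_subset[of _ "Pow X"]) (use insert.hyps in \<open>auto simp: inj_on_def\<close>)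
    have "?Sh X (A \<union> B) \<subseteq> ?Sh (insert a X) F"
    proof
      fix T assume T: "T \<in> ?Sh X (A \<union> B)"
      have "\<exists>e\<in>F. e \<inter> T = U" if "U \<subseteq> T" for U
      proof -
        have "\<exists>e\<in>A \<union> B. e \<inter> T = U" using T that by simp
        then obtain e where "e \<in> A \<union> B" "e \<inter> T = U" ..
        moreover have "a \<notin> T" using T insert.hyps by auto
        ultimately show ?thesis
          unfolding A_def B_def by auto
      qed
      moreover have "T \<subseteq> insert a X" using T by auto
      ultimately show "T \<in> ?Sh (insert a X) F" by simp
    qed
    moreover have "insert a ` ?Sh X (A \<inter> B) \<subseteq> ?Sh (insert a X) F"
    proof
      fix T' assume "T' \<in> insert a ` ?Sh X (A \<inter> B)"
      then obtain T where T: "T \<in> ?Sh X (A \<inter> B)" "T' = insert a T" ..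
      have "a \<notin> T" using T insert.hyps by auto
      have "\<exists>e\<in>F. e \<inter> insert a T = U" if U: "U \<subseteq> insert a T" for U
      proof -
        have "U - {a} \<subseteq> T" using U by auto
        with T(1) have "\<exists>e\<in>A \<inter> B. e \<inter> T = U - {a}" by simp
        then obtain e where e: "e \<in> A \<inter> B" "e \<inter> T = U - {a}" ..
        from e(1) obtain e' where e': "e' \<in> F" "a \<in> e'" "e = e' - {a}"
          unfolding B_def by blast
        \<comment> \<open>Membership of \<open>e\<close> in both \<open>A\<close> and
          \<open>B\<close> supplies two members of \<open>F\<close> that differ only at
          \<open>a\<close>, one for each choice of whether \<open>a\<close> belongs to
          \<open>U\<close>.\<close>
        have "insert a e = e'" unfolding e'(3) using e'(2) by (rule insert_Diff)
        with e(1) e'(1) have F: "e \<in> F" "insert a e \<in> F" and "a \<notin> e"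
          unfolding A_def by simp_all
        show ?thesis
        proof (cases "a \<in> U")
          case True
          have "insert a e \<inter> insert a T = insert a (e \<inter> T)" by blast
          then have "insert a e \<inter> insert a T = U" using True U by (simp add: e(2) insert_absorb)
          then show ?thesis using F(2) by (rule bexI)
        next
          case False
          then have "e \<inter> insert a T = U" using e(2) \<open>a \<notin> e\<close> by simp
          then show ?thesis using F(1) by (rule bexI)
        qed
      qed
      moreover have "T' \<subseteq> insert a X" using T by auto
      ultimately show "T' \<in> ?Sh (insert a X) F" using T(2) by simp
    qed
    ultimately have "card (?Sh X (A \<union> B) \<union> insert a ` ?Sh X (A \<inter> B)) \<le> card (?Sh (insert a X) F)"
      using insert.hyps by (intro card_mono) auto
    moreover have "a \<notin> T" if "T \<in> ?Sh X (A \<union> B)" for T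
      using that insert.hyps(2) by (simp only: mem_Collect_eq) (meson subsetD)
    then have "?Sh X (A \<union> B) \<inter> insert a ` ?Sh X (A \<inter> B) = {}"
      by (metis (no_types, lifting) disjoint_iff imageE insertI1)
    then have "card (?Sh X (A \<union> B) \<union> insert a ` ?Sh X (A \<inter> B))
        = card (?Sh X (A \<union> B)) + card (?Sh X (A \<inter> B))"
      using insert.hyps by (subst card_Un_disjoint) (simp_all add: card_image[OF inj])
    ultimately show ?thesis by linarith
  qed
  ultimately show ?case by linarith
qed

lemma card_subsets_card_le:
  "card {T. T \<subseteq> {..<n::nat} \<and> card T \<le> d} \<le> (n + 1) ^ d"
proof (induction d)
  case 0
  have "{T. T \<subseteq> {..<n} \<and> card T \<le> 0} = {{}}"
    by (auto dest: finite_subset[OF _ finite_lessThan])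
  then show ?case by simp
next
  case (Suc d)
  let ?S = "{T. T \<subseteq> {..<n} \<and> card T \<le> d}"
  have "{T. T \<subseteq> {..<n} \<and> card T \<le> Suc d} \<subseteq> ?S \<union> (\<lambda>(i, T). insert i T) ` ({..<n} \<times> ?S)"
  proof
    fix T assume "T \<in> {T. T \<subseteq> {..<n} \<and> card T \<le> Suc d}"
    then have T: "T \<subseteq> {..<n}" "card T \<le> Suc d" and "finite T" by (auto intro: finite_subset)
    show "T \<in> ?S \<union> (\<lambda>(i, T). insert i T) ` ({..<n} \<times> ?S)"
    proof (cases "T = {}")
      case False
      then obtain i where "i \<in> T" by auto
      then have "(i, T - {i}) \<in> {..<n} \<times> ?S" "T = insert i (T - {i})"
        using T \<open>finite T\<close> by (auto simp: card_Diff_singleton)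
      then show ?thesis by (metis (no_types, lifting) UnI2 case_prod_conv image_eqI)
    qed auto
  qed
  then have "card {T. T \<subseteq> {..<n} \<and> card T \<le> Suc d}
      \<le> card (?S \<union> (\<lambda>(i, T). insert i T) ` ({..<n} \<times> ?S))"
    by (rule card_mono[rotated]) auto
  also have "\<dots> \<le> card ?S + n * card ?S"
    using card_image_le[of "{..<n} \<times> ?S" "\<lambda>(i, T). insert i T"]
    by (intro order_trans[OF card_Un_le]) (simp add: card_cartesian_product)
  also have "\<dots> = (n + 1) * card ?S" by simp
  also have "\<dots> \<le> (n + 1) ^ Suc d" unfolding power_Suc by (intro mult_left_mono Suc) simp
  finally show ?case .
qed

lemma card_le_vc_dim:
  assumes "finite S" "shatters C S" "vc_dim C \<le> enat d"
  shows "card S \<le> d"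
proof -
  have "enat (card S) \<le> vc_dim C"
    unfolding vc_dim_def using assms(1,2) by (intro SUP_upper) simp
  with assms(3) show ?thesis by (metis enat_ord_simps(1) order_trans)
qed

text \<open>Sauer's bound for patterns of indices, so that \<open>z\<close> may repeat points.
  Comparing with the fixed \<open>f\<close> only flips labels, which preserves shattering. A
  shattered set of indices is thus mapped injectively onto a set shattered by \<open>C\<close>, and
  has at most \<open>d\<close> elements.\<close>

lemma card_error_patterns_le:
  fixes z :: "nat \<Rightarrow> 'a"
  assumes "vc_dim C \<le> enat d"
  shows "card ((\<lambda>h. {j. j < n \<and> h (z j) \<noteq> f (z j)}) ` C) \<le> (n + 1) ^ d"
proof -
  let ?F = "(\<lambda>h. {j. j < n \<and> h (z j) \<noteq> f (z j)}) ` C"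
  have "card ?F \<le> card {T. T \<subseteq> {..<n} \<and> (\<forall>U\<subseteq>T. \<exists>e\<in>?F. e \<inter> T = U)}"
    by (rule card_le_card_shattered) auto
  also have "\<dots> \<le> card {T. T \<subseteq> {..<n} \<and> card T \<le> d}"
  proof (intro card_mono subsetI)
    fix T assume "T \<in> {T. T \<subseteq> {..<n} \<and> (\<forall>U\<subseteq>T. \<exists>e\<in>?F. e \<inter> T = U)}"
    then have T: "T \<subseteq> {..<n}" and sh: "\<forall>U\<subseteq>T. \<exists>e\<in>?F. e \<inter> T = U" by simp_all
    have ex: "\<exists>h\<in>C. \<forall>j\<in>T. (h (z j) \<noteq> f (z j)) = (j \<in> U)" if "U \<subseteq> T" for U
    proof -
      have "\<exists>e\<in>?F. e \<inter> T = U" using sh that by simp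
      then obtain e where e: "e \<in> ?F" "e \<inter> T = U" ..
      from e(1) obtain h where "h \<in> C" "e = {j. j < n \<and> h (z j) \<noteq> f (z j)}" ..
      then show ?thesis using e(2) T by (intro bexI[of _ h]) auto
    qed
    \<comment> \<open>A classifier takes equal values at equal points, so a pattern that singles out
      one index separates the points.\<close>
    have inj: "inj_on z T"
    proof (rule inj_onI)
      fix i j assume "i \<in> T" "j \<in> T" "z i = z j"
      moreover obtain h where "\<forall>j\<in>T. (h (z j) \<noteq> f (z j)) = (j \<in> {i})"
        using ex[of "{i}"] \<open>i \<in> T\<close> by blast
      ultimately show "i = j" by (metis singleton_iff)
    qed
    have "shatters C (z ` T)"
      unfolding shatters_def
    proof safe
      fix U assume "U \<subseteq> z ` T"
      obtain h where "h \<in> C" "\<forall>j\<in>T. (h (z j) \<noteq> f (z j)) = (j \<in> {j\<in>T. (z j \<in> U) \<noteq> f (z j)})"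
        using ex[of "{j\<in>T. (z j \<in> U) \<noteq> f (z j)}"] by blast
      then show "\<exists>h\<in>C. \<forall>x\<in>z ` T. h x = (x \<in> U)"
        by (intro bexI[of _ h]) auto
    qed
    then have "card (z ` T) \<le> d"
      using T finite_subset by (intro card_le_vc_dim[OF _ _ assms]) blast
    then show "T \<in> {T. T \<subseteq> {..<n} \<and> card T \<le> d}" using inj T by (simp add: card_image)
  qed simp
  also have "\<dots> \<le> (n + 1) ^ d" by (rule card_subsets_card_le)
  finally show ?thesis .
qed

section \<open>Swapping the halves of a double sample\<close>

definition swap_halves :: "nat \<Rightarrow> nat set \<Rightarrow> nat \<Rightarrow> nat" where
  "swap_halves m \<sigma> j =
     (if j < m \<and> j \<in> \<sigma> then m + j else if m \<le> j \<and> j < 2 * m \<and> j - m \<in> \<sigma> then j - m else j)"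

lemma swap_halves_simps:
  "i < m \<Longrightarrow> swap_halves m \<sigma> i = (if i \<in> \<sigma> then m + i else i)"
  "i < m \<Longrightarrow> swap_halves m \<sigma> (m + i) = (if i \<in> \<sigma> then i else m + i)"
  by (auto simp: swap_halves_def)

lemma inj_swap_halves: "inj (swap_halves m \<sigma>)"
  by (rule injI) (auto simp: swap_halves_def split: if_splits)

lemma swap_halves_less: "j < 2 * m \<Longrightarrow> swap_halves m \<sigma> j < 2 * m"
  by (auto simp: swap_halves_def)

text \<open>On every pair \<open>i, m + i\<close> that meets \<open>e\<close> the swap is forced.\<close>

lemma card_swaps_le:
  fixes a :: real
  shows "real (card {\<sigma>. \<sigma> \<subseteq> {..<m} \<and> (\<forall>i<m. swap_halves m \<sigma> i \<notin> e) \<and>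
            a \<le> real (card {i. i < m \<and> swap_halves m \<sigma> (m + i) \<in> e})}) \<le> 2 powr (real m - a)"
    (is "real (card ?A) \<le> _")
proof (cases "?A = {}")
  case False
  define T where "T = {i. i < m \<and> (i \<in> e \<or> m + i \<in> e)}"
  have sub: "{i. i < m \<and> swap_halves m \<sigma> (m + i) \<in> e} \<subseteq> T" for \<sigma>
    by (auto simp: T_def swap_halves_simps split: if_splits)
  have T: "T \<subseteq> {..<m}" "finite T" by (auto simp: T_def)
  have aT: "a \<le> real (card T)"
    using False card_mono[OF T(2) sub] by (auto intro: order_trans)
  \<comment> \<open>Since the swaps inside \<open>T\<close> are forced, \<open>\<sigma>\<close> is
    recovered from \<open>\<sigma> - T\<close>, which leaves \<open>m - card T\<close> free choices.
    Any single member of the set shows that \<open>card T\<close> is at least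
    \<open>a\<close>.\<close>
  have "inj_on (\<lambda>\<sigma>. \<sigma> - T) ?A"
  proof (rule inj_onI)
    fix \<sigma> \<tau> assume *: "\<sigma> \<in> ?A" "\<tau> \<in> ?A" "\<sigma> - T = \<tau> - T"
    have "\<rho> \<inter> T = {i\<in>T. i \<in> e}" if "\<rho> \<in> ?A" for \<rho>
      using that by (auto simp: T_def swap_halves_simps split: if_splits)
    then have "\<sigma> \<inter> T = \<tau> \<inter> T" using * by simp
    then show "\<sigma> = \<tau>" using *(3) by blast
  qed
  then have "card ?A = card ((\<lambda>\<sigma>. \<sigma> - T) ` ?A)" by (simp add: card_image)
  also have "\<dots> \<le> card (Pow ({..<m} - T))"
    by (rule card_mono) auto
  also have "\<dots> = 2 ^ (m - card T)"
    using T by (simp add: card_Pow card_Diff_subset)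
  finally have "real (card ?A) \<le> real (2 ^ (m - card T))"
    by (simp only: of_nat_le_iff)
  then have "real (card ?A) \<le> 2 ^ (m - card T)" by simp
  also have "\<dots> = 2 powr (real m - real (card T))"
    using card_mono[of "{..<m}" T] T by (simp add: powr_realpow[symmetric] of_nat_diff)
  also have "\<dots> \<le> 2 powr (real m - a)" using aT by simp
  finally show ?thesis .
next
  case True
  then show ?thesis by (simp only: card.empty) simp
qed

subsection \<open>Sequences of independent points\<close>

context prob_space
begin

lemma sequence_space: "sequence_space M"
  by unfold_locales

lemma prob_space_sequences: "prob_space (PiM UNIV (\<lambda>_::nat. M))"
  by (intro prob_space_PiM prob_space_axioms)

text \<open>The points from index \<open>k\<close> on form an independent sequence with the same
  law, so conditioning on the first \<open>k\<close> points becomes an iterated integral.\<close>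

lemma nn_integral_comb_seq:
  assumes [measurable]: "F \<in> borel_measurable (PiM UNIV (\<lambda>_::nat. M))"
  shows "(\<integral>\<^sup>+x. F x \<partial>PiM UNIV (\<lambda>_::nat. M)) =
    (\<integral>\<^sup>+s. \<integral>\<^sup>+w. F (comb_seq k s w) \<partial>PiM UNIV (\<lambda>_::nat. M) \<partial>PiM UNIV (\<lambda>_::nat. M))"
proof -
  interpret sequence_space M by (rule sequence_space)
  have "(\<integral>\<^sup>+x. F x \<partial>S) = (\<integral>\<^sup>+x. F x \<partial>distr (S \<Otimes>\<^sub>M S) S (\<lambda>(\<omega>, \<omega>'). comb_seq k \<omega> \<omega>'))"
    by (simp add: PiM_comb_seq)
  also have "\<dots> = (\<integral>\<^sup>+p. F (comb_seq k (fst p) (snd p)) \<partial>(S \<Otimes>\<^sub>M S))"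
    by (subst nn_integral_distr) (auto simp: split_beta)
  also have "\<dots> = (\<integral>\<^sup>+s. \<integral>\<^sup>+w. F (comb_seq k s w) \<partial>S \<partial>S)"
    by (subst P.nn_integral_fst[symmetric]) auto
  finally show ?thesis .
qed

lemma nn_integral_reindex:
  assumes [measurable]: "F \<in> borel_measurable (PiM UNIV (\<lambda>_::nat. M))" and "inj g"
  shows "(\<integral>\<^sup>+x. F (\<lambda>i. x (g i)) \<partial>PiM UNIV (\<lambda>_::nat. M)) = (\<integral>\<^sup>+x. F x \<partial>PiM UNIV (\<lambda>_::nat. M))"
proof -
  have [measurable]: "(\<lambda>x i. x (g i)) \<in> PiM UNIV (\<lambda>_::nat. M) \<rightarrow>\<^sub>M PiM UNIV (\<lambda>_::nat. M)"
    by (rule measurable_PiM_single') (auto simp: space_PiM PiE_iff)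
  have "distr (PiM UNIV (\<lambda>_::nat. M)) (PiM UNIV (\<lambda>_::nat. M)) (\<lambda>x i. x (g i)) = PiM UNIV (\<lambda>_::nat. M)"
    using distr_PiM_reindex[of UNIV "\<lambda>_. M" g UNIV] assms(2) prob_space_axioms
    by (simp add: restrict_UNIV)
  then have "(\<integral>\<^sup>+x. F x \<partial>PiM UNIV (\<lambda>_::nat. M)) =
      (\<integral>\<^sup>+x. F x \<partial>distr (PiM UNIV (\<lambda>_::nat. M)) (PiM UNIV (\<lambda>_::nat. M)) (\<lambda>x i. x (g i)))"
    by simp
  also have "\<dots> = (\<integral>\<^sup>+x. F (\<lambda>i. x (g i)) \<partial>PiM UNIV (\<lambda>_::nat. M))"
    by (subst nn_integral_distr) auto
  finally show ?thesis ..
qed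

lemma nn_integral_prod_sequence:
  assumes [measurable]: "g \<in> borel_measurable M"
  shows "(\<integral>\<^sup>+x. (\<Prod>i<k. g (x i)) \<partial>PiM UNIV (\<lambda>_::nat. M)) = (\<integral>\<^sup>+x. g x \<partial>M) ^ k"
proof (induction k)
  case 0
  interpret SS: prob_space "PiM UNIV (\<lambda>_::nat. M)" by (rule prob_space_sequences)
  show ?case by (simp add: SS.emeasure_space_1)
next
  case (Suc k)
  interpret sequence_space M by (rule sequence_space)
  have "(\<integral>\<^sup>+x. (\<Prod>i<Suc k. g (x i)) \<partial>S) =
      (\<integral>\<^sup>+x. (\<Prod>i<Suc k. g (x i)) \<partial>distr (M \<Otimes>\<^sub>M S) S (\<lambda>(s, \<omega>). case_nat s \<omega>))"
    by (simp add: PiM_iter)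
  also have "\<dots> = (\<integral>\<^sup>+p. g (fst p) * (\<Prod>i<k. g (snd p i)) \<partial>(M \<Otimes>\<^sub>M S))"
    by (subst nn_integral_distr) (auto simp: split_beta prod.lessThan_Suc_shift simp del: prod.lessThan_Suc)
  also have "\<dots> = (\<integral>\<^sup>+x. g x * (\<integral>\<^sup>+y. (\<Prod>i<k. g (y i)) \<partial>S) \<partial>M)"
    by (subst P.nn_integral_fst[symmetric]) (auto simp: nn_integral_cmult)
  also have "\<dots> = (\<integral>\<^sup>+x. g x \<partial>M) ^ Suc k"
    by (simp add: Suc.IH nn_integral_multc)
  finally show ?case .
qed

section \<open>Exponential tail bounds for the number of hits\<close>

lemma measurable_count[measurable]:
  assumes [measurable]: "D \<in> sets M"
  shows "(\<lambda>x. real (card {i. i < k \<and> x i \<in> D})) \<in> borel_measurable (PiM UNIV (\<lambda>_::nat. M))"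
proof -
  have "(\<lambda>x. real (card {i. i < k \<and> x i \<in> D})) = (\<lambda>x. \<Sum>i<k. indicator D (x i))"
    by (simp add: fun_eq_iff indicator_def sum.If_cases lessThan_def Collect_conj_eq[symmetric])
  then show ?thesis by simp
qed

text \<open>Exponential moment and Markov's inequality. The event carries \<open>t\<close> on both
  sides so that one statement serves both tails: a negative \<open>t\<close> reverses the inequality
  on the count.\<close>

lemma chernoff:
  fixes t a :: real
  assumes [measurable]: "D \<in> sets M"
  shows "emeasure (PiM UNIV (\<lambda>_::nat. M))
      {x \<in> space (PiM UNIV (\<lambda>_::nat. M)). t * a \<le> t * real (card {i. i < k \<and> x i \<in> D})}
    \<le> ennreal (exp (real k * prob D * (exp t - 1) - t * a))" (is "emeasure ?S ?A \<le> _")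
proof -
  let ?cnt = "\<lambda>x. card {i. i < k \<and> x i \<in> D}"
  have cnt: "ennreal (exp (t * real (?cnt x))) = (\<Prod>i<k. ennreal (if x i \<in> D then exp t else 1))" for x
  proof -
    have "exp (t * real (?cnt x)) = exp t ^ card ({..<k} \<inter> {i. x i \<in> D})"
      by (simp add: exp_of_nat_mult[symmetric] mult.commute lessThan_def Collect_conj_eq)
    also have "\<dots> = (\<Prod>i<k. if x i \<in> D then exp t else 1)"
      by (simp add: prod.If_cases)
    finally show ?thesis by (simp add: prod_ennreal)
  qed
  have "emeasure ?S ?A = emeasure ?S {x \<in> space ?S. 1 \<le> ennreal (exp (- t * a)) * ennreal (exp (t * real (?cnt x)))}"
    by (intro arg_cong2[where f=emeasure] refl Collect_cong conj_cong)
       (simp add: ennreal_mult[symmetric] exp_add[symmetric] del: ennreal_1 add: ennreal_1[symmetric])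
  also have "\<dots> \<le> ennreal (exp (- t * a)) * (\<integral>\<^sup>+x. ennreal (exp (t * real (?cnt x))) \<partial>?S)"
    using nn_integral_Markov_inequality[of "\<lambda>x. ennreal (exp (t * real (?cnt x)))" "space ?S" ?S "ennreal (exp (- t * a))"]
    by (simp cong: nn_integral_cong)
  also have "(\<integral>\<^sup>+x. ennreal (exp (t * real (?cnt x))) \<partial>?S) = (\<integral>\<^sup>+x. ennreal (if x \<in> D then exp t else 1) \<partial>M) ^ k"
    unfolding cnt by (rule nn_integral_prod_sequence) simp
  also have "(\<integral>\<^sup>+x. ennreal (if x \<in> D then exp t else 1) \<partial>M) = ennreal (1 + prob D * (exp t - 1))"
  proof -
    have "(\<integral>\<^sup>+x. ennreal (if x \<in> D then exp t else 1) \<partial>M) =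
        (\<integral>\<^sup>+x. ennreal (exp t) * indicator D x + indicator (space M - D) x \<partial>M)"
      by (intro nn_integral_cong) (auto simp: indicator_def)
    also have "\<dots> = ennreal (exp t) * emeasure M D + emeasure M (space M - D)"
      by (subst nn_integral_add) (auto simp: nn_integral_cmult_indicator)
    also have "\<dots> = ennreal (1 + prob D * (exp t - 1))"
      by (simp add: emeasure_eq_measure prob_compl ennreal_mult[symmetric] ennreal_plus[symmetric]
          algebra_simps del: ennreal_plus)
    finally show ?thesis .
  qed
  also have "ennreal (exp (- t * a)) * ennreal (1 + prob D * (exp t - 1)) ^ k
      \<le> ennreal (exp (- t * a)) * ennreal (exp (prob D * (exp t - 1))) ^ k"
    by (intro mult_left_mono power_mono ennreal_leI exp_ge_add_one_self) auto
  also have "\<dots> = ennreal (exp (real k * prob D * (exp t - 1) - t * a))"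
    by (simp add: ennreal_power ennreal_mult[symmetric] exp_of_nat_mult[symmetric] exp_add[symmetric] algebra_simps)
  finally show ?thesis .
qed

lemma chernoff_lower:
  assumes [measurable]: "D \<in> sets M"
  shows "emeasure (PiM UNIV (\<lambda>_::nat. M))
      {x \<in> space (PiM UNIV (\<lambda>_::nat. M)). real (card {i. i < k \<and> x i \<in> D}) \<le> real k * prob D / 2}
    \<le> ennreal (exp (- real k * prob D / 10))"
proof -
  \<comment> \<open>With \<open>t = -1\<close> the exponent is
    \<open>real k * prob D * (exp (-1) - 1 + 1 / 2)\<close>, and \<open>exp 1 \<ge> 5 / 2\<close>
    makes the bracket at most \<open>- 1 / 10\<close>.\<close>
  have "(5/2::real) \<le> exp 1"
    using exp_lower_Taylor_quadratic[of 1] by simp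
  then have "exp (-1) - 1 + 1 / 2 \<le> (- 1 / 10 :: real)"
    by (simp add: exp_minus field_simps)
  then have "real k * prob D * (exp (-1) - 1 + 1 / 2) \<le> real k * prob D * (- 1 / 10)"
    by (intro mult_left_mono) auto
  then have "ennreal (exp (real k * prob D * (exp (-1) - 1) - (-1) * (real k * prob D / 2)))
      \<le> ennreal (exp (- real k * prob D / 10))"
    by (intro ennreal_leI) (simp add: algebra_simps)
  then show ?thesis
    using order_trans[OF chernoff[OF assms, of "-1" "real k * prob D / 2" k]] by simp
qed

lemma chernoff_upper:
  assumes [measurable]: "D \<in> sets M" and b: "real k * prob D \<le> b"
  shows "emeasure (PiM UNIV (\<lambda>_::nat. M))
      {x \<in> space (PiM UNIV (\<lambda>_::nat. M)). 2 * b \<le> real (card {i. i < k \<and> x i \<in> D})}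
    \<le> ennreal (exp (- b / 4))"
proof -
  have "0 \<le> b" using b by (meson measure_nonneg mult_nonneg_nonneg of_nat_0_le_iff order_trans)
  \<comment> \<open>With \<open>t = 1 / 2\<close> the exponent is at most
    \<open>3 / 4 * b - b\<close>. A freely chosen bound \<open>b\<close> in place of the mean keeps
    the failure probability small even for rare sets.\<close>
  have "exp (1/2) \<le> 1 + 1/2 + (1/2 :: real)\<^sup>2" by (rule exp_bound) auto
  then have e: "exp (1/2) - 1 \<le> (3/4::real)" by (simp add: power2_eq_square)
  have "real k * prob D * (exp (1/2) - 1) \<le> b * (3/4)"
    using b e \<open>0 \<le> b\<close> by (intro mult_mono) auto
  then have "ennreal (exp (real k * prob D * (exp (1/2) - 1) - (1/2) * (2 * b))) \<le> ennreal (exp (- b / 4))"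
    by (intro ennreal_leI) simp
  then show ?thesis
    using order_trans[OF chernoff[OF assms(1), of "1/2" "2 * b" k]] by (simp add: mult.commute)
qed

end

subsection \<open>Measurability of version spaces\<close>

text \<open>The standing assumption concerns a fixed label pattern, whereas here the labels vary
  with \<open>\<omega>\<close>. There are finitely many patterns on \<open>m\<close> indices, so the
  event is a finite union over the set \<open>U\<close> of indices labeled
  \<open>True\<close>.\<close>

lemma measurable_pattern:
  fixes m :: nat
  assumes C: "measurable_class C"
    and X: "\<And>i. i < m \<Longrightarrow> X i \<in> N \<rightarrow>\<^sub>M borel"
    and Y: "\<And>i. i < m \<Longrightarrow> Y i \<in> N \<rightarrow>\<^sub>M count_space UNIV"
  shows "Measurable.pred N (\<lambda>\<omega>. \<exists>h\<in>C. \<forall>i<m. h (X i \<omega>) = Y i \<omega>)"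
proof -
  have "(\<lambda>\<omega> i. if i < m then X i \<omega> else undefined) \<in> N \<rightarrow>\<^sub>M PiM UNIV (\<lambda>_. borel)"
  proof (intro measurable_PiM_single')
    show "(\<lambda>\<omega>. if i < m then X i \<omega> else undefined) \<in> borel_measurable N" for i
      using X[of i] by (cases "i < m") simp_all
  qed simp
  note meas = measurable_sets[OF this]
  have p: "Measurable.pred N (\<lambda>\<omega>. \<exists>h\<in>C. \<forall>i<m. h (X i \<omega>) = (i \<in> U))" for U :: "nat set"
  proof -
    have "{x. \<exists>h\<in>C. \<forall>i<m. h (x i) = (i \<in> U)} \<in> sets (PiM UNIV (\<lambda>_::nat. borel))"
      using C[unfolded measurable_class_def, THEN conjunct1, rule_format, of m "\<lambda>i. i \<in> U"] .
    from meas[OF this] show ?thesis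
      by (simp add: pred_def vimage_def Int_def conj_commute cong: conj_cong)
  qed
  have "Measurable.pred N (\<lambda>\<omega>. \<exists>U\<in>Pow {..<m}. (\<forall>i\<in>{..<m}. Y i \<omega> = (i \<in> U)) \<and>
      (\<exists>h\<in>C. \<forall>i<m. h (X i \<omega>) = (i \<in> U)))"
  proof (rule pred_intros_finite)
    fix U assume "U \<in> Pow {..<m}"
    have "Measurable.pred N (\<lambda>\<omega>. Y i \<omega> = (i \<in> U))" if "i \<in> {..<m}" for i
      using Y[of i] that by simp
    then have "Measurable.pred N (\<lambda>\<omega>. \<forall>i\<in>{..<m}. Y i \<omega> = (i \<in> U))"
      by (intro pred_intros_finite) auto
    then show "Measurable.pred N (\<lambda>\<omega>. (\<forall>i\<in>{..<m}. Y i \<omega> = (i \<in> U)) \<and>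
        (\<exists>h\<in>C. \<forall>i<m. h (X i \<omega>) = (i \<in> U)))"
      using p by (rule pred_intros_logic)
  qed simp
  also have "(\<lambda>\<omega>. \<exists>U\<in>Pow {..<m}. (\<forall>i\<in>{..<m}. Y i \<omega> = (i \<in> U)) \<and>
      (\<exists>h\<in>C. \<forall>i<m. h (X i \<omega>) = (i \<in> U))) = (\<lambda>\<omega>. \<exists>h\<in>C. \<forall>i<m. h (X i \<omega>) = Y i \<omega>)"
  proof (rule ext, rule iffI)
    fix \<omega> assume "\<exists>h\<in>C. \<forall>i<m. h (X i \<omega>) = Y i \<omega>"
    then show "\<exists>U\<in>Pow {..<m}. (\<forall>i\<in>{..<m}. Y i \<omega> = (i \<in> U)) \<and> (\<exists>h\<in>C. \<forall>i<m. h (X i \<omega>) = (i \<in> U))"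
      by (intro bexI[of _ "{i\<in>{..<m}. Y i \<omega>}"]) auto
  next
    fix \<omega> assume "\<exists>U\<in>Pow {..<m}. (\<forall>i\<in>{..<m}. Y i \<omega> = (i \<in> U)) \<and> (\<exists>h\<in>C. \<forall>i<m. h (X i \<omega>) = (i \<in> U))"
    then obtain U h where "\<forall>i\<in>{..<m}. Y i \<omega> = (i \<in> U)" "h \<in> C" "\<forall>i<m. h (X i \<omega>) = (i \<in> U)" by blast
    then show "\<exists>h\<in>C. \<forall>i<m. h (X i \<omega>) = Y i \<omega>" by (intro bexI[of _ h]) auto
  qed
  finally show ?thesis .
qed

lemma version_space_map:
  "version_space C (map (\<lambda>i. (x i, y i)) [0..<k]) = {h\<in>C. \<forall>i<k. h (x i) = y i}"
  unfolding version_space_def set_map Set.ball_simps(9) by (simp add: Ball_def)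

text \<open>With two labels, disagreement at \<open>z\<close> means that both values occur there.
  This turns membership in \<open>DIS\<close> into two realizable-pattern events on
  \<open>k + 1\<close> points.\<close>

lemma mem_DIS_version_space:
  "z \<in> DIS (version_space C (map (\<lambda>i. (x i, y i)) [0..<k])) \<longleftrightarrow>
    (\<exists>h\<in>C. (\<forall>i<k. h (x i) = y i) \<and> h z) \<and> (\<exists>h\<in>C. (\<forall>i<k. h (x i) = y i) \<and> \<not> h z)"
  (is "_ \<longleftrightarrow> ?T \<and> ?F")
proof
  assume "z \<in> DIS (version_space C (map (\<lambda>i. (x i, y i)) [0..<k]))"
  then obtain g h where *: "g \<in> C" "\<forall>i<k. g (x i) = y i" "h \<in> C" "\<forall>i<k. h (x i) = y i" "g z \<noteq> h z"
    unfolding DIS_def version_space_map by blast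
  show "?T \<and> ?F"
  proof (cases "g z")
    case True
    then show ?thesis using * by (intro conjI bexI[of _ g] bexI[of _ h]) auto
  next
    case False
    then show ?thesis using * by (intro conjI bexI[of _ h] bexI[of _ g]) auto
  qed
next
  assume "?T \<and> ?F"
  then obtain g h where *: "g \<in> C" "\<forall>i<k. g (x i) = y i" "h \<in> C" "\<forall>i<k. h (x i) = y i" "g z" "\<not> h z"
    by blast
  then have "g \<in> version_space C (map (\<lambda>i. (x i, y i)) [0..<k])" "h \<in> version_space C (map (\<lambda>i. (x i, y i)) [0..<k])"
    by (simp_all add: version_space_map)
  with *(5,6) show "z \<in> DIS (version_space C (map (\<lambda>i. (x i, y i)) [0..<k]))"
    unfolding DIS_def by (simp only: mem_Collect_eq) metis
qed

lemma measurable_mem_DIS: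
  assumes C: "measurable_class C"
    and X: "\<And>i. i < k \<Longrightarrow> X i \<in> N \<rightarrow>\<^sub>M borel"
    and Y: "\<And>i. i < k \<Longrightarrow> Y i \<in> N \<rightarrow>\<^sub>M count_space UNIV"
    and Z: "Z \<in> N \<rightarrow>\<^sub>M borel"
  shows "Measurable.pred N (\<lambda>\<omega>. Z \<omega> \<in> DIS (version_space C (map (\<lambda>i. (X i \<omega>, Y i \<omega>)) [0..<k])))"
proof -
  have "Measurable.pred N (\<lambda>\<omega>. \<exists>h\<in>C. \<forall>i<Suc k. h ((if i < k then X i else Z) \<omega>) = (if i < k then Y i else (\<lambda>_. b)) \<omega>)" for b
    by (rule measurable_pattern[OF C]) (auto intro: X Y Z)
  moreover have "(\<forall>i<Suc k. h ((if i < k then X i else Z) \<omega>) = (if i < k then Y i else (\<lambda>_. b)) \<omega>)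
      \<longleftrightarrow> (\<forall>i<k. h (X i \<omega>) = Y i \<omega>) \<and> h (Z \<omega>) = b" for b h \<omega>
    by (auto simp: less_Suc_eq)
  ultimately have "Measurable.pred N (\<lambda>\<omega>. \<exists>h\<in>C. (\<forall>i<k. h (X i \<omega>) = Y i \<omega>) \<and> h (Z \<omega>) = b)" for b
    by simp
  from this[of True] this[of False] show ?thesis
    unfolding mem_DIS_version_space by simp
qed

subsection \<open>Uniform convergence of the version space\<close>

text \<open>The polynomial is the growth function bound on \<open>2 * m\<close> points; the factor 2
  is the price of Markov's inequality at level \<open>1 / 2\<close> in the symmetrization.\<close>

lemma polynomial_times_exp_bound:
  fixes c :: real
  assumes "c > 0"
  shows "\<exists>m0. \<forall>m\<ge>m0. 2 * (2 * real m + 1) ^ d * exp (- c * real m) \<le> 1"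
proof -
  have "((\<lambda>x::real. 2 * (2 * x + 1) ^ d * exp (- c * x)) \<longlongrightarrow> 0) at_top"
    using assms by real_asymp
  then have "((\<lambda>m. 2 * (2 * real m + 1) ^ d * exp (- c * real m)) \<longlongrightarrow> 0) sequentially"
    by (rule filterlim_compose[OF _ filterlim_real_sequentially])
  then have "eventually (\<lambda>m. 2 * (2 * real m + 1) ^ d * exp (- c * real m) < 1) sequentially"
    by (rule order_tendstoD) simp
  then show ?thesis
    unfolding eventually_sequentially by (meson less_imp_le)
qed

locale target_distribution =
  fixes C :: "'a::topological_space classifier set" and P :: "'a measure" and f :: "'a classifier"
  assumes vc: "vc_class C" and meas: "measurable_class C"
    and distr: "distribution P" and f: "f \<in> C"
begin

sublocale prob_space P
  using distr by (simp add: distribution_def)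

lemma sets_P[measurable_cong]: "sets P = sets borel"
  using distr by (simp add: distribution_def)

lemma space_P[simp]: "space P = UNIV"
  using sets_eq_imp_space_eq[OF sets_P] by simp

abbreviation Seq :: "(nat \<Rightarrow> 'a) measure" where
  "Seq \<equiv> PiM UNIV (\<lambda>_::nat. P)"

lemma space_Seq[simp]: "space Seq = UNIV"
  by (simp add: space_PiM PiE_def)

sublocale Seq: prob_space Seq
  by (rule prob_space_sequences)

lemma classifier_measurable[measurable]: "h \<in> C \<Longrightarrow> h \<in> borel \<rightarrow>\<^sub>M count_space UNIV"
  using vc by (simp add: vc_class_def)

lemma f_measurable[measurable]: "f \<in> borel \<rightarrow>\<^sub>M count_space UNIV"
  using f by (rule classifier_measurable)

lemma sets_error[measurable]: "h \<in> C \<Longrightarrow> {x. h x \<noteq> f x} \<in> sets P"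
proof -
  assume [measurable]: "h \<in> C"
  have "Measurable.pred borel (\<lambda>x. h x \<noteq> f x)" by measurable
  then show ?thesis by (simp add: sets_P pred_def)
qed

definition V :: "nat \<Rightarrow> (nat \<Rightarrow> 'a) \<Rightarrow> 'a classifier set" where
  "V k s = version_space C (map (\<lambda>i. (s i, f (s i))) [0..<k])"

lemma V_eq: "V k s = {h\<in>C. \<forall>i<k. h (s i) = f (s i)}"
  unfolding V_def by (rule version_space_map)

lemma f_in_V: "f \<in> V k s"
  using f by (simp add: V_eq)

lemma component_measurable[measurable]: "(\<lambda>s. s i) \<in> Seq \<rightarrow>\<^sub>M borel"
  using measurable_component_singleton[of i UNIV "\<lambda>_. P"] by (simp add: measurable_cong_sets[OF refl sets_P])

lemma mem_DIS_V_measurable: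
  assumes X: "X \<in> N \<rightarrow>\<^sub>M Seq" and Z: "Z \<in> N \<rightarrow>\<^sub>M borel"
  shows "Measurable.pred N (\<lambda>\<omega>. Z \<omega> \<in> DIS (V k (X \<omega>)))"
proof -
  have [measurable]: "(\<lambda>\<omega>. X \<omega> i) \<in> N \<rightarrow>\<^sub>M borel" for i
    using measurable_compose[OF X component_measurable] .
  show ?thesis
    unfolding V_def by (rule measurable_mem_DIS[OF meas _ _ Z]) measurable
qed

lemma sets_DIS_V[measurable]: "DIS (V k s) \<in> sets P"
proof -
  have "s \<in> space Seq" by simp
  then have "(\<lambda>_. s) \<in> borel \<rightarrow>\<^sub>M Seq" by (rule measurable_const)
  moreover have "(\<lambda>z. z) \<in> borel \<rightarrow>\<^sub>M borel" by simp
  ultimately have "Measurable.pred borel (\<lambda>z. z \<in> DIS (V k s))"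
    by (rule mem_DIS_V_measurable)
  then show ?thesis by (simp add: pred_def sets_P)
qed

lemma prob_DIS_V_measurable[measurable]: "(\<lambda>s. prob (DIS (V k s))) \<in> borel_measurable Seq"
proof -
  have "Measurable.pred (Seq \<Otimes>\<^sub>M P) (\<lambda>p. snd p \<in> DIS (V k (fst p)))"
    by (rule mem_DIS_V_measurable) measurable
  then have "{p \<in> space (Seq \<Otimes>\<^sub>M P). snd p \<in> DIS (V k (fst p))} \<in> sets (Seq \<Otimes>\<^sub>M P)"
    by (simp add: pred_def)
  from measurable_emeasure_Pair[OF this] show ?thesis
    by (simp add: measure_def vimage_def space_pair_measure)
qed

text \<open>The quantifier runs over error patterns instead of classifiers: for fixed
  \<open>z\<close> there are finitely many, and a finite VC dimension makes their number polynomial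
  in \<open>m\<close>, as the union bound requires.\<close>

definition double_sample_failure :: "real \<Rightarrow> nat \<Rightarrow> (nat \<Rightarrow> 'a) \<Rightarrow> bool" where
  "double_sample_failure a m z \<longleftrightarrow>
     (\<exists>e\<in>(\<lambda>h. {j. j < 2 * m \<and> h (z j) \<noteq> f (z j)}) ` C.
        (\<forall>i<m. i \<notin> e) \<and> a \<le> real (card {i. i < m \<and> m + i \<in> e}))"

lemma double_sample_failure_measurable[measurable]:
  "Measurable.pred Seq (double_sample_failure a m)"
proof -
  let ?Q = "\<lambda>U. (\<forall>i<m. i \<notin> U) \<and> a \<le> real (card {i. i < m \<and> m + i \<in> U})"
  have eq: "double_sample_failure a m z \<longleftrightarrow>
      (\<exists>U\<in>Pow {..<2 * m}. (\<exists>h\<in>C. \<forall>i<2*m. h (z i) = ((i \<in> U) \<noteq> f (z i))) \<and> ?Q U)" for z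
  proof
    assume "double_sample_failure a m z"
    then obtain h where h: "h \<in> C" "?Q {j. j < 2 * m \<and> h (z j) \<noteq> f (z j)}"
      unfolding double_sample_failure_def by blast
    show "\<exists>U\<in>Pow {..<2 * m}. (\<exists>h\<in>C. \<forall>i<2*m. h (z i) = ((i \<in> U) \<noteq> f (z i))) \<and> ?Q U"
      by (rule bexI[of _ "{j. j < 2 * m \<and> h (z j) \<noteq> f (z j)}"], rule conjI[OF _ h(2)], rule bexI[OF _ h(1)]) auto
  next
    assume "\<exists>U\<in>Pow {..<2 * m}. (\<exists>h\<in>C. \<forall>i<2*m. h (z i) = ((i \<in> U) \<noteq> f (z i))) \<and> ?Q U"
    then obtain U h where U: "U \<subseteq> {..<2 * m}" "h \<in> C" "\<forall>i<2*m. h (z i) = ((i \<in> U) \<noteq> f (z i))" "?Q U"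
      by blast
    have "{j. j < 2 * m \<and> h (z j) \<noteq> f (z j)} = U"
      using U(1,3) by auto
    then show "double_sample_failure a m z"
      unfolding double_sample_failure_def using U(2,4) by blast
  qed
  \<comment> \<open>An error set \<open>U\<close> amounts to the label pattern
    \<open>(i \<in> U) \<noteq> f (z i)\<close>, which varies with \<open>z\<close>, as
    \<open>measurable_pattern\<close> allows.\<close>
  have "Measurable.pred Seq (\<lambda>z. \<exists>h\<in>C. \<forall>i<2*m. h (z i) = ((i \<in> U) \<noteq> f (z i)))" for U
    by (rule measurable_pattern[OF meas]) measurable
  then have "Measurable.pred Seq (\<lambda>z. (\<exists>h\<in>C. \<forall>i<2*m. h (z i) = ((i \<in> U) \<noteq> f (z i))) \<and> ?Q U)" for U
    by (rule pred_intros_logic) simp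
  then have "Measurable.pred Seq (\<lambda>z. \<exists>U\<in>Pow {..<2 * m}.
      (\<exists>h\<in>C. \<forall>i<2*m. h (z i) = ((i \<in> U) \<noteq> f (z i))) \<and> ?Q U)"
    by (intro pred_intros_finite) auto
  then show ?thesis
    by (subst measurable_cong[OF eq]) 
qed

text \<open>Swapping replaces an error pattern by its preimage under the swap. The patterns of the
  unswapped \<open>z\<close> therefore serve all swaps at once, and the union bound costs their
  number.\<close>

lemma card_failing_swaps:
  assumes "vc_dim C \<le> enat d"
  shows "real (card {\<sigma> \<in> Pow {..<m}. double_sample_failure a m (\<lambda>i. z (swap_halves m \<sigma> i))})
    \<le> (2 * real m + 1) ^ d * 2 powr (real m - a)"
proof -
  let ?E = "(\<lambda>h. {j. j < 2 * m \<and> h (z j) \<noteq> f (z j)}) ` C"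
  let ?A = "\<lambda>e. {\<sigma>. \<sigma> \<subseteq> {..<m} \<and> (\<forall>i<m. swap_halves m \<sigma> i \<notin> e) \<and>
      a \<le> real (card {i. i < m \<and> swap_halves m \<sigma> (m + i) \<in> e})}"
  have "?E \<subseteq> Pow {..<2 * m}" by auto
  then have fin: "finite ?E" by (rule finite_subset) simp
  have "{\<sigma> \<in> Pow {..<m}. double_sample_failure a m (\<lambda>i. z (swap_halves m \<sigma> i))} \<subseteq> (\<Union>e\<in>?E. ?A e)"
  proof
    fix \<sigma> assume "\<sigma> \<in> {\<sigma> \<in> Pow {..<m}. double_sample_failure a m (\<lambda>i. z (swap_halves m \<sigma> i))}"
    then have \<sigma>: "\<sigma> \<subseteq> {..<m}" and "double_sample_failure a m (\<lambda>i. z (swap_halves m \<sigma> i))"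
      by simp_all
    then obtain h where h: "h \<in> C"
      "\<forall>i<m. i \<notin> {j. j < 2 * m \<and> h (z (swap_halves m \<sigma> j)) \<noteq> f (z (swap_halves m \<sigma> j))}"
      "a \<le> real (card {i. i < m \<and> m + i \<in> {j. j < 2 * m \<and> h (z (swap_halves m \<sigma> j)) \<noteq> f (z (swap_halves m \<sigma> j))}})"
      unfolding double_sample_failure_def by blast
    have eq: "j \<in> {j. j < 2 * m \<and> h (z (swap_halves m \<sigma> j)) \<noteq> f (z (swap_halves m \<sigma> j))} \<longleftrightarrow>
      swap_halves m \<sigma> j \<in> {j. j < 2 * m \<and> h (z j) \<noteq> f (z j)}" if "j < 2 * m" for j
      using that swap_halves_less[OF that] by simp
    have "\<sigma> \<in> ?A {j. j < 2 * m \<and> h (z j) \<noteq> f (z j)}"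
    proof (intro CollectI conjI \<sigma> allI impI)
      fix i assume "i < m"
      then show "swap_halves m \<sigma> i \<notin> {j. j < 2 * m \<and> h (z j) \<noteq> f (z j)}"
        using h(2) by (subst eq[symmetric]) auto
    next
      have "{i. i < m \<and> m + i \<in> {j. j < 2 * m \<and> h (z (swap_halves m \<sigma> j)) \<noteq> f (z (swap_halves m \<sigma> j))}}
        = {i. i < m \<and> swap_halves m \<sigma> (m + i) \<in> {j. j < 2 * m \<and> h (z j) \<noteq> f (z j)}}"
        by (intro Collect_cong conj_cong refl eq) simp
      then show "a \<le> real (card {i. i < m \<and> swap_halves m \<sigma> (m + i) \<in> {j. j < 2 * m \<and> h (z j) \<noteq> f (z j)}})"
        using h(3) by simp
    qed
    then show "\<sigma> \<in> (\<Union>e\<in>?E. ?A e)" using h(1) by blast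
  qed
  then have "card {\<sigma> \<in> Pow {..<m}. double_sample_failure a m (\<lambda>i. z (swap_halves m \<sigma> i))} \<le> card (\<Union>e\<in>?E. ?A e)"
    by (rule card_mono[rotated]) (rule finite_UN_I[OF fin], rule finite_subset[of _ "Pow {..<m}"], blast, simp)
  also have "\<dots> \<le> (\<Sum>e\<in>?E. card (?A e))"
    by (rule card_UN_le[OF fin])
  finally have "real (card {\<sigma> \<in> Pow {..<m}. double_sample_failure a m (\<lambda>i. z (swap_halves m \<sigma> i))})
      \<le> (\<Sum>e\<in>?E. real (card (?A e)))"
    unfolding of_nat_sum[symmetric] by (simp only: of_nat_le_iff)
  also have "\<dots> \<le> (\<Sum>e\<in>?E. 2 powr (real m - a))"
    by (rule sum_mono) (rule card_swaps_le)
  also have "\<dots> = real (card ?E) * 2 powr (real m - a)" by simp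
  also have "real (card ?E) \<le> real ((2 * m + 1) ^ d)"
    using card_error_patterns_le[OF assms, of "2 * m" z f] of_nat_le_iff by blast
  finally show ?thesis by (simp add: mult_right_mono add.commute)
qed

text \<open>The law of the sequence is invariant under each of the \<open>2 ^ m\<close> swaps, so
  the probability equals its average over them. Exchanging sum and integral leaves, for each fixed
  \<open>z\<close>, the fraction of failing swaps.\<close>

lemma emeasure_double_sample_failure:
  assumes "vc_dim C \<le> enat d"
  shows "emeasure Seq {z. double_sample_failure a m z} \<le> ennreal ((2 * real m + 1) ^ d * 2 powr (- a))"
proof -
  let ?B = "{z. double_sample_failure a m z}"
  let ?b = "(2 * real m + 1) ^ d * 2 powr (- a)"
  have B[measurable]: "?B \<in> sets Seq"
    using double_sample_failure_measurable[of a m] by (simp add: pred_def)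
  have [measurable]: "(\<lambda>x i. x (g i)) \<in> Seq \<rightarrow>\<^sub>M Seq" for g :: "nat \<Rightarrow> nat"
    by (rule measurable_PiM_single') (auto simp: space_PiM PiE_iff)
  have "ennreal (2 ^ m) * emeasure Seq ?B = (\<Sum>\<sigma>\<in>Pow {..<m}. emeasure Seq ?B)"
    by (simp add: card_Pow ennreal_power[symmetric])
  also have "\<dots> = (\<Sum>\<sigma>\<in>Pow {..<m}. \<integral>\<^sup>+z. indicator ?B (\<lambda>i. z (swap_halves m \<sigma> i)) \<partial>Seq)"
    by (intro sum.cong refl, subst nn_integral_reindex[OF _ inj_swap_halves]) simp_all
  also have "\<dots> = (\<integral>\<^sup>+z. (\<Sum>\<sigma>\<in>Pow {..<m}. indicator ?B (\<lambda>i. z (swap_halves m \<sigma> i))) \<partial>Seq)"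
    by (intro nn_integral_sum[symmetric]) measurable
  also have "\<dots> \<le> (\<integral>\<^sup>+z. ennreal (2 ^ m * ?b) \<partial>Seq)"
  proof (rule nn_integral_mono)
    fix z :: "nat \<Rightarrow> 'a"
    have "(\<Sum>\<sigma>\<in>Pow {..<m}. indicator ?B (\<lambda>i. z (swap_halves m \<sigma> i))) =
        ennreal (real (card {\<sigma> \<in> Pow {..<m}. double_sample_failure a m (\<lambda>i. z (swap_halves m \<sigma> i))}))"
      by (simp add: indicator_def sum.If_cases Int_def ennreal_of_nat_eq_real_of_nat)
    also have "\<dots> \<le> ennreal ((2 * real m + 1) ^ d * 2 powr (real m - a))"
      by (rule ennreal_leI[OF card_failing_swaps[OF assms]])
    also have "(2 * real m + 1) ^ d * 2 powr (real m - a) = 2 ^ m * ?b"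
      by (simp add: powr_diff powr_minus powr_realpow field_simps)
    finally show "(\<Sum>\<sigma>\<in>Pow {..<m}. indicator ?B (\<lambda>i. z (swap_halves m \<sigma> i))) \<le> ennreal (2 ^ m * ?b)" .
  qed
  also have "\<dots> = ennreal (2 ^ m) * ennreal ?b"
    using Seq.emeasure_space_1 by (simp add: ennreal_mult)
  finally show ?thesis
    by (simp add: ennreal_mult_le_mult_iff)
qed

end

lemma exponential_tail_eventually_le_half:
  fixes r :: real
  assumes "r > 0"
  shows "\<exists>m0. \<forall>m\<ge>m0. exp (- real m * r) \<le> 1 / 2"
proof (intro exI allI impI)
  fix m assume "m \<ge> nat \<lceil>ln 2 / r\<rceil>"
  then have "ln 2 / r \<le> real m" by linarith
  then have "- real m * r \<le> - ln 2" using assms by (simp add: field_simps)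
  then have "exp (- real m * r) \<le> exp (- ln 2)" by (simp only: exp_le_cancel_iff)
  then show "exp (- real m * r) \<le> 1 / 2" by (simp add: exp_minus)
qed

lemma DIS_I: "g \<in> H \<Longrightarrow> h \<in> H \<Longrightarrow> g x \<noteq> h x \<Longrightarrow> x \<in> DIS H"
  unfolding DIS_def by (intro CollectI bexI)

lemma DIS_E:
  assumes "x \<in> DIS H"
  obtains g h where "g \<in> H" "h \<in> H" "g x \<noteq> h x"
  using assms unfolding DIS_def mem_Collect_eq by (elim bexE)

lemma DIS_mono: "H \<subseteq> H' \<Longrightarrow> DIS H \<subseteq> DIS H'"
proof (rule subsetI, erule DIS_E)
  fix x g h assume "H \<subseteq> H'" "g \<in> H" "h \<in> H" "g x \<noteq> h x"
  then show "x \<in> DIS H'" using DIS_I[of g H' h x] by auto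
qed

context target_distribution
begin

text \<open>
  The event that some consistent classifier has a large error need not be measurable. It is covered
  by the measurable set of those first halves that a random second half completes to a double
  sample failure with probability at least \<open>1/2\<close>.
\<close>

lemma version_space_in_ball:
  assumes r: "r > 0"
  shows "\<exists>c>0. \<exists>m0. \<forall>m\<ge>m0. \<exists>A\<in>sets Seq. emeasure Seq A \<le> ennreal (exp (- c * real m)) \<and>
    (\<forall>s. s \<notin> A \<longrightarrow> V m s \<subseteq> concept_ball C P f r)"
proof -
  obtain d where d: "vc_dim C = enat d"
    using vc by (auto simp: vc_class_def)
  \<comment> \<open>The bound \<open>2 powr (- a)\<close> equals
    \<open>exp (- 2 * c * real m)\<close>: one factor \<open>exp (- c * real m)\<close> absorbs the
    polynomial, the other is the final rate.\<close>
  define c where "c = r * ln 2 / 4"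
  have "c > 0" using r by (simp add: c_def)
  obtain m1 where m1: "\<And>m. m \<ge> m1 \<Longrightarrow> exp (- real m * (r / 10)) \<le> 1 / 2"
    using exponential_tail_eventually_le_half[of "r / 10"] r by auto
  obtain m2 where m2: "\<And>m. m \<ge> m2 \<Longrightarrow> 2 * (2 * real m + 1) ^ d * exp (- c * real m) \<le> 1"
    using polynomial_times_exp_bound[OF \<open>c > 0\<close>, of d] by auto
  have "\<exists>A\<in>sets Seq. emeasure Seq A \<le> ennreal (exp (- c * real m)) \<and>
    (\<forall>s. s \<notin> A \<longrightarrow> V m s \<subseteq> concept_ball C P f r)" if m: "m \<ge> max m1 m2" for m
  proof -
    \<comment> \<open>Half of \<open>r * real m\<close>: outside the lower tail event, a classifier
      with error above \<open>r\<close> makes at least this many errors on the second half.\<close>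
    define a where "a = r * real m / 2"
    define B where "B = {z. double_sample_failure a m z}"
    define u where "u s = (\<integral>\<^sup>+w. indicator B (comb_seq m s w) \<partial>Seq)" for s
    define A where "A = {s. 1 \<le> 2 * u s}"
    have B[measurable]: "B \<in> sets Seq"
      using double_sample_failure_measurable[of a m] by (simp add: pred_def B_def)
    have u[measurable]: "u \<in> borel_measurable Seq"
      unfolding u_def by measurable
    have "{s \<in> space Seq. 1 \<le> 2 * u s} \<in> sets Seq" by measurable
    then have A: "A \<in> sets Seq" by (simp add: A_def)
    \<comment> \<open>Markov's inequality at level \<open>1 / 2\<close> for the conditional failure
      probability \<open>u\<close>, whose mean is the probability of \<open>B\<close>.\<close>
    have "emeasure Seq A \<le> 2 * (\<integral>\<^sup>+s. u s \<partial>Seq)"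
      using nn_integral_Markov_inequality[of u UNIV Seq 2] by (simp add: A_def) (metis sets.top space_Seq)
    also have "(\<integral>\<^sup>+s. u s \<partial>Seq) = emeasure Seq B"
      unfolding u_def by (subst nn_integral_comb_seq[symmetric]) simp_all
    also have "emeasure Seq B \<le> ennreal ((2 * real m + 1) ^ d * 2 powr (- a))"
      unfolding B_def by (rule emeasure_double_sample_failure) (simp add: d)
    finally have "emeasure Seq A \<le> 2 * ennreal ((2 * real m + 1) ^ d * 2 powr (- a))"
      by (simp add: mult_left_mono)
    also have "\<dots> = ennreal ((2 * (2 * real m + 1) ^ d * exp (- c * real m)) * exp (- c * real m))"
    proof -
      have "2 powr (- a) = exp (- c * real m) * exp (- c * real m)"
        by (simp add: powr_def a_def c_def exp_add[symmetric])
      then show ?thesis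
        by (simp add: ennreal_mult'[symmetric] ennreal_numeral[symmetric] ac_simps del: ennreal_numeral)
    qed
    also have "\<dots> \<le> ennreal (1 * exp (- c * real m))"
      by (intro ennreal_leI mult_right_mono m2) (use m in auto)
    finally have "emeasure Seq A \<le> ennreal (exp (- c * real m))" by simp
    moreover have "V m s \<subseteq> concept_ball C P f r" if "s \<notin> A" for s
    proof (rule ccontr)
      assume "\<not> V m s \<subseteq> concept_ball C P f r"
      then obtain h where h: "h \<in> V m s" "h \<notin> concept_ball C P f r" by blast
      define D where "D = {x. h x \<noteq> f x}"
      have hC: "h \<in> C" and hs: "\<And>i. i < m \<Longrightarrow> h (s i) = f (s i)"
        using h(1) by (auto simp: V_eq)
      have D[measurable]: "D \<in> sets P" unfolding D_def by (rule sets_error[OF hC])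
      have rD: "r < prob D" using h(2) hC by (simp add: concept_ball_def D_def)
      let ?E = "{w \<in> space Seq. real (card {i. i < m \<and> w i \<in> D}) \<le> real m * prob D / 2}"
      have E: "?E \<in> sets Seq" by measurable
      have sub: "UNIV - ?E \<subseteq> {w. comb_seq m s w \<in> B}"
      proof
        fix w assume w: "w \<in> UNIV - ?E"
        let ?e = "{j. j < 2 * m \<and> h (comb_seq m s w j) \<noteq> f (comb_seq m s w j)}"
        have "\<forall>i<m. i \<notin> ?e" using hs by (simp add: comb_seq_less)
        moreover have "{i. i < m \<and> m + i \<in> ?e} = {i. i < m \<and> w i \<in> D}"
          by (intro Collect_cong conj_cong refl)
             (simp add: D_def comb_seq_add[of m s w, unfolded add.commute[of _ m]])
        moreover have "a \<le> real (card {i. i < m \<and> w i \<in> D})"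
        proof -
          have "real m * r \<le> real m * prob D" using rD by (intro mult_left_mono) auto
          then show ?thesis using w by (simp add: a_def mult.commute)
        qed
        ultimately show "w \<in> {w. comb_seq m s w \<in> B}"
          unfolding B_def double_sample_failure_def using hC
          by (intro CollectI bexI[of _ ?e]) auto
      qed
      have "emeasure Seq ?E \<le> ennreal (exp (- real m * prob D / 10))"
        by (rule chernoff_lower[OF D])
      also have "\<dots> \<le> ennreal (1 / 2)"
      proof (rule ennreal_leI)
        have "exp (- real m * prob D / 10) \<le> exp (- real m * (r / 10))"
          using rD by (simp add: mult_left_mono)
        also have "\<dots> \<le> 1 / 2" using m1 m by simp
        finally show "exp (- real m * prob D / 10) \<le> 1 / 2" .
      qed
      finally have "ennreal (Seq.prob ?E) \<le> ennreal (1 / 2)"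
        unfolding Seq.emeasure_eq_measure .
      then have "Seq.prob ?E \<le> 1 / 2"
        by (subst (asm) ennreal_le_iff) simp_all
      then have "1 / 2 \<le> Seq.prob (UNIV - ?E)"
        using Seq.prob_compl[OF E] by simp
      then have "ennreal (1 / 2) \<le> emeasure Seq (UNIV - ?E)"
        unfolding Seq.emeasure_eq_measure by (rule ennreal_leI)
      also have "\<dots> = (\<integral>\<^sup>+w. indicator (UNIV - ?E) w \<partial>Seq)"
        using sets.compl_sets[OF E] by simp
      also have "\<dots> \<le> u s"
        unfolding u_def by (intro nn_integral_mono) (use sub in \<open>auto simp: indicator_def\<close>)
      finally have "2 * ennreal (1 / 2) \<le> 2 * u s" by (rule mult_left_mono) simp
      moreover have "2 * ennreal (1 / 2) = 1"
        using ennreal_mult[of 2 "1 / 2"] by simp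
      ultimately have "1 \<le> 2 * u s" by simp
      then show False using that by (simp add: A_def)
    qed
    ultimately show ?thesis using A by blast
  qed
  then show ?thesis using \<open>c > 0\<close> by blast
qed

section \<open>Shrinking balls and the disagreement core\<close>

lemma sets_DIS_ball: "r > 0 \<Longrightarrow> DIS (concept_ball C P f r) \<in> sets P"
  using meas f distr unfolding measurable_class_def sets_P by blast

text \<open>A countable family of radii suffices by monotonicity; it gives measurability of the core
  and continuity from above.\<close>

lemma core_eq: "disagreement_core C P f = (\<Inter>n. DIS (concept_ball C P f (1 / real (Suc n))))"
proof
  show "disagreement_core C P f \<subseteq> (\<Inter>n. DIS (concept_ball C P f (1 / real (Suc n))))"
    unfolding disagreement_core_def by (auto intro: INF_lower)
  show "(\<Inter>n. DIS (concept_ball C P f (1 / real (Suc n)))) \<subseteq> disagreement_core C P f"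
    unfolding disagreement_core_def
  proof (intro INT_greatest)
    fix r :: real assume "r \<in> {0<..}"
    then obtain n where "1 / real (Suc n) < r"
      using nat_approx_posE by (metis greaterThan_iff)
    then have "concept_ball C P f (1 / real (Suc n)) \<subseteq> concept_ball C P f r"
      by (auto simp: concept_ball_def)
    then show "(\<Inter>n. DIS (concept_ball C P f (1 / real (Suc n)))) \<subseteq> DIS (concept_ball C P f r)"
      using DIS_mono by blast
  qed
qed

lemma sets_core: "disagreement_core C P f \<in> sets P"
  unfolding core_eq by (intro sets.countable_INT' sets_DIS_ball) (auto simp: sets_DIS_ball)

lemma prob_DIS_ball_small:
  assumes "prob (disagreement_core C P f) = 0" "\<delta> > 0"
  shows "\<exists>r>0. prob (DIS (concept_ball C P f r)) < \<delta>"
proof -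
  have "decseq (\<lambda>n. DIS (concept_ball C P f (1 / real (Suc n))))"
  proof (rule decseq_SucI, rule DIS_mono)
    fix n
    have "1 / real (Suc (Suc n)) \<le> 1 / real (Suc n)" by (simp add: field_simps)
    then show "concept_ball C P f (1 / real (Suc (Suc n))) \<subseteq> concept_ball C P f (1 / real (Suc n))"
      unfolding concept_ball_def by auto
  qed
  then have "(\<lambda>n. prob (DIS (concept_ball C P f (1 / real (Suc n))))) \<longlonglongrightarrow> prob (disagreement_core C P f)"
    unfolding core_eq by (intro finite_Lim_measure_decseq) (auto simp: sets_DIS_ball)
  then have "eventually (\<lambda>n. prob (DIS (concept_ball C P f (1 / real (Suc n)))) < \<delta>) sequentially"
    using assms by (intro order_tendstoD(2)) auto
  then obtain n where "prob (DIS (concept_ball C P f (1 / real (Suc n)))) < \<delta>"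
    by (auto simp: eventually_sequentially)
  then show ?thesis by (intro exI[of _ "1 / real (Suc n)"]) auto
qed

lemma prob_DIS_V_large:
  assumes "prob (disagreement_core C P f) = 0" "\<delta> > 0"
  shows "\<exists>c>0. \<exists>m0. \<forall>m\<ge>m0. emeasure Seq {s. \<delta> < prob (DIS (V m s))} \<le> ennreal (exp (- c * real m))"
proof -
  obtain r where r: "r > 0" "prob (DIS (concept_ball C P f r)) < \<delta>"
    using prob_DIS_ball_small[OF assms] by blast
  obtain c m0 where c: "c > 0" and m0: "\<And>m. m \<ge> m0 \<Longrightarrow> \<exists>A\<in>sets Seq. emeasure Seq A \<le> ennreal (exp (- c * real m)) \<and>
    (\<forall>s. s \<notin> A \<longrightarrow> V m s \<subseteq> concept_ball C P f r)"
    using version_space_in_ball[OF r(1)] by blast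
  have "emeasure Seq {s. \<delta> < prob (DIS (V m s))} \<le> ennreal (exp (- c * real m))" if m: "m \<ge> m0" for m
  proof -
    obtain A where A: "A \<in> sets Seq" "emeasure Seq A \<le> ennreal (exp (- c * real m))"
      "\<And>s. s \<notin> A \<Longrightarrow> V m s \<subseteq> concept_ball C P f r"
      using m0[OF m] by blast
    have "{s. \<delta> < prob (DIS (V m s))} \<subseteq> A"
    proof (rule subsetI, rule ccontr)
      fix s assume s: "s \<in> {s. \<delta> < prob (DIS (V m s))}" "s \<notin> A"
      have "prob (DIS (V m s)) \<le> prob (DIS (concept_ball C P f r))"
        by (intro finite_measure_mono DIS_mono A(3) s sets_DIS_ball r)
      then show False using s r by simp
    qed
    then show ?thesis using A(1,2) by (meson emeasure_mono order_trans)
  qed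
  then show ?thesis using c by blast
qed

text \<open>
  A classifier with error at most \<open>r\<close> that differs from \<open>f\<close> in \<open>z\<close> survives \<open>k\<close> labels with
  probability at least \<open>1 - k * r\<close>, and \<open>r\<close> is arbitrary.
\<close>

lemma core_in_DIS_V:
  assumes z: "z \<in> disagreement_core C P f"
  shows "emeasure Seq {s. z \<in> DIS (V k s)} = 1"
proof -
  let ?N = "{s. z \<notin> DIS (V k s)}"
  have "Measurable.pred Seq (\<lambda>s. z \<in> DIS (V k s))"
    by (rule mem_DIS_V_measurable) measurable
  then have N: "{s \<in> space Seq. z \<in> DIS (V k s)} \<in> sets Seq"
    unfolding pred_def .
  have "Seq.prob ?N \<le> e" if "e > 0" for e
  proof -
    \<comment> \<open>The union bound over \<open>k\<close> points costs \<open>real k * r\<close>;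
      the added 1 keeps \<open>r\<close> positive and finite also for \<open>k = 0\<close>.\<close>
    define r where "r = e / (real k + 1)"
    have r: "r > 0" using that by (simp add: r_def)
    then have "z \<in> DIS (concept_ball C P f r)"
      using z by (auto simp: disagreement_core_def)
    \<comment> \<open>Two members of the ball disagree at \<open>z\<close> and labels are Boolean,
      so one of them differs from \<open>f\<close> there.\<close>
    then obtain h where h: "h \<in> concept_ball C P f r" "h z \<noteq> f z"
      by (rule DIS_E) (metis (full_types))
    define D where "D = {x. h x \<noteq> f x}"
    have hC: "h \<in> C" and hr: "prob D \<le> r" using h(1) by (auto simp: concept_ball_def D_def)
    have D[measurable]: "D \<in> sets P" unfolding D_def by (rule sets_error[OF hC])
    have Di: "{s. s i \<in> D} \<in> sets Seq" "Seq.prob {s. s i \<in> D} = prob D" for i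
    proof -
      have m: "(\<lambda>s. s i) \<in> Seq \<rightarrow>\<^sub>M P" by measurable
      show "{s. s i \<in> D} \<in> sets Seq"
        using measurable_sets[OF m D] by (simp add: vimage_def)
      have "prob D = measure (distr Seq P (\<lambda>s. s i)) D"
        using distr_PiM_component[of UNIV "\<lambda>_::nat. P" i] prob_space_axioms by simp
      also have "\<dots> = Seq.prob {s. s i \<in> D}"
        by (subst measure_distr[OF m D]) (simp add: vimage_def)
      finally show "Seq.prob {s. s i \<in> D} = prob D" ..
    qed
    have "?N \<subseteq> (\<Union>i\<in>{..<k}. {s. s i \<in> D})"
    proof (rule subsetI, rule ccontr)
      fix s assume s: "s \<in> ?N" "s \<notin> (\<Union>i\<in>{..<k}. {s. s i \<in> D})"
      then have "h \<in> V k s" using hC by (simp add: V_eq D_def)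
      then have "z \<in> DIS (V k s)" using f_in_V[of k s] h(2) by (rule DIS_I)
      then show False using s by simp
    qed
    then have "Seq.prob ?N \<le> Seq.prob (\<Union>i\<in>{..<k}. {s. s i \<in> D})"
      using Di by (intro Seq.finite_measure_mono) auto
    also have "\<dots> \<le> (\<Sum>i\<in>{..<k}. Seq.prob {s. s i \<in> D})"
      using Di by (intro measure_UNION_le) auto
    also have "\<dots> \<le> real k * r" using hr by (simp add: Di mult_left_mono)
    also have "\<dots> \<le> e" using that by (simp add: r_def field_simps)
    finally show ?thesis .
  qed
  then have "Seq.prob ?N \<le> 0" by (rule field_le_epsilon[of _ 0, simplified])
  then have "Seq.prob ?N = 0" by (simp add: measure_le_0_iff)
  moreover have "?N = space Seq - {s. z \<in> DIS (V k s)}" by auto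
  ultimately have "Seq.prob {s. z \<in> DIS (V k s)} = 1"
    using Seq.prob_compl[of "{s. z \<in> DIS (V k s)}"] N by simp
  then show ?thesis by (simp add: Seq.emeasure_eq_measure)
qed

text \<open>By Fubini the right-hand side averages over \<open>z\<close> the probability that
  \<open>z\<close> lies in the region of disagreement, and this is 1 for every \<open>z\<close> in
  the core.\<close>

lemma prob_core_le:
  "emeasure P (disagreement_core C P f) \<le> (\<integral>\<^sup>+s. emeasure P (DIS (V k s)) \<partial>Seq)"
proof -
  have m: "Measurable.pred (Seq \<Otimes>\<^sub>M P) (\<lambda>p. snd p \<in> DIS (V k (fst p)))"
    by (rule mem_DIS_V_measurable) measurable
  have m1: "Measurable.pred Seq (\<lambda>s. z \<in> DIS (V k s))" for z
    by (rule mem_DIS_V_measurable) measurable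
  interpret pair_sigma_finite Seq P ..
  have "emeasure P (disagreement_core C P f) = (\<integral>\<^sup>+z. indicator (disagreement_core C P f) z \<partial>P)"
    using sets_core by simp
  also have "\<dots> \<le> (\<integral>\<^sup>+z. emeasure Seq {s. z \<in> DIS (V k s)} \<partial>P)"
    by (intro nn_integral_mono) (auto simp: indicator_def core_in_DIS_V)
  also have "\<dots> = (\<integral>\<^sup>+z. \<integral>\<^sup>+s. indicator {p. snd p \<in> DIS (V k (fst p))} (s, z) \<partial>Seq \<partial>P)"
  proof (intro nn_integral_cong)
    fix z
    have "{s. z \<in> DIS (V k s)} \<in> sets Seq" using m1[of z] by (simp add: pred_def)
    then have "emeasure Seq {s. z \<in> DIS (V k s)} = (\<integral>\<^sup>+s. indicator {s. z \<in> DIS (V k s)} s \<partial>Seq)"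
      by simp
    then show "emeasure Seq {s. z \<in> DIS (V k s)} =
        (\<integral>\<^sup>+s. indicator {p. snd p \<in> DIS (V k (fst p))} (s, z) \<partial>Seq)"
      by (simp add: indicator_def)
  qed
  also have "\<dots> = (\<integral>\<^sup>+s. \<integral>\<^sup>+z. indicator {p. snd p \<in> DIS (V k (fst p))} (s, z) \<partial>P \<partial>Seq)"
  proof (rule Fubini')
    have "{p \<in> space (Seq \<Otimes>\<^sub>M P). snd p \<in> DIS (V k (fst p))} \<in> sets (Seq \<Otimes>\<^sub>M P)"
      using m by (simp add: pred_def)
    then show "(\<lambda>(s, z). indicator {p. snd p \<in> DIS (V k (fst p))} (s, z)) \<in> borel_measurable (Seq \<Otimes>\<^sub>M P)"
      unfolding case_prod_eta by (intro borel_measurable_indicator) (simp add: space_pair_measure)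
  qed
  also have "\<dots> = (\<integral>\<^sup>+s. \<integral>\<^sup>+z. indicator (DIS (V k s)) z \<partial>P \<partial>Seq)"
    by (simp add: indicator_def)
  also have "\<dots> = (\<integral>\<^sup>+s. emeasure P (DIS (V k s)) \<partial>Seq)" by simp
  finally show ?thesis .
qed

end

subsection \<open>Runs of Meta-Algorithm 0\<close>

lemma run_map_strategy [simp]: "run y (map_strategy g st) = g (run y st)"
  by (induction st) auto

lemma requests_map_strategy [simp]: "requests y (map_strategy g st) = requests y st"
  by (induction st) auto

lemma run_request_labels [simp]: "run y (request_labels is k) = run y (k (map y is))"
  by (induction "is" arbitrary: k) auto

lemma requests_request_labels [simp]:
  "requests y (request_labels is k) = length is + requests y (k (map y is))"
  by (induction "is" arbitrary: k) auto

lemma requests_label_loop: "t \<le> n \<Longrightarrow> requests y (label_loop D g n x ms t L) \<le> n - t"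
proof (induction ms arbitrary: t L)
  case (Cons m ms)
  show ?case
  proof (cases "x m \<in> D \<and> t < n")
    case True
    then have "requests y (label_loop D g n x ms (Suc t) (L @ [(x m, y m)])) \<le> n - Suc t"
      by (intro Cons.IH) simp
    then have "Suc (requests y (label_loop D g n x ms (Suc t) (L @ [(x m, y m)]))) \<le> n - t"
      using True by linarith
    then show ?thesis using True by simp
  next
    case False
    then show ?thesis using Cons by auto
  qed
qed simp

text \<open>Once the answers are given by \<open>y\<close>, the strategy tree collapses to a fold
  whose state is the request count and the sample built so far.\<close>

definition loop_step ::
  "'a set \<Rightarrow> ('a sample \<Rightarrow> 'a \<Rightarrow> 'a classifier) \<Rightarrow> nat \<Rightarrow> (nat \<Rightarrow> 'a) \<Rightarrow> (nat \<Rightarrow> bool)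
    \<Rightarrow> nat \<times> 'a sample \<Rightarrow> nat \<Rightarrow> nat \<times> 'a sample" where
  "loop_step D g n x y = (\<lambda>(t, L) m.
     if x m \<in> D \<and> t < n then (Suc t, L @ [(x m, y m)]) else (t, L @ [(x m, g L (x m) (x m))]))"

lemma run_label_loop: "run y (label_loop D g n x ms t L) = snd (foldl (loop_step D g n x y) (t, L) ms)"
proof (induction ms arbitrary: t L)
  case (Cons m ms)
  then show ?case by (cases "x m \<in> D \<and> t < n") (auto simp: loop_step_def)
qed simp

definition initial_sample :: "nat \<Rightarrow> (nat \<Rightarrow> 'a) \<Rightarrow> (nat \<Rightarrow> bool) \<Rightarrow> 'a sample" where
  "initial_sample n x y = map (\<lambda>i. (x i, y i)) [0..<n div 2]"

definition estimate :: "'a set \<Rightarrow> nat \<Rightarrow> (nat \<Rightarrow> 'a) \<Rightarrow> real" where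
  "estimate D n x = max (2 / (real n)\<^sup>2 * (\<Sum>i\<in>{n\<^sup>2..<2 * n\<^sup>2}. indicator D (x i))) (4 / real n)"

definition loop_length :: "'a set \<Rightarrow> nat \<Rightarrow> (nat \<Rightarrow> 'a) \<Rightarrow> nat" where
  "loop_length D n x = nat \<lfloor>real n / (4 * estimate D n x)\<rfloor>"

lemma run_meta_algorithm_0:
  "run y (meta_algorithm_0 C pick Ap n u x) =
    (let S = initial_sample n x y; D = DIS (version_space C S) in
       Ap u (snd (foldl (loop_step D (pick S) n x y) (n div 2, [])
         [n div 2..<n div 2 + loop_length D n x])))"
proof -
  have "zip (map x is) (map y is) = map (\<lambda>i. (x i, y i)) is" for "is"
    by (induction "is") auto
  then show ?thesis
    by (simp add: meta_algorithm_0_def Let_def run_label_loop initial_sample_def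
        loop_length_def estimate_def)
qed

lemma requests_meta_algorithm_0: "requests y (meta_algorithm_0 C pick Ap n u x) \<le> n"
proof -
  have "n div 2 + requests y (label_loop D g n x ms (n div 2) []) \<le> n" for D g ms
    using requests_label_loop[of "n div 2" n y D g x ms "[]"] by linarith
  then show ?thesis
    by (simp add: meta_algorithm_0_def Let_def)
qed

section \<open>Joint measurability of the output\<close>

lemma measurable_choice:
  assumes "valid_choice_rule C pick"
    and X: "\<And>i. i < k \<Longrightarrow> X i \<in> N \<rightarrow>\<^sub>M borel" "\<And>i. i < k \<Longrightarrow> Y i \<in> N \<rightarrow>\<^sub>M count_space UNIV"
    and W: "\<And>i. i < l \<Longrightarrow> W i \<in> N \<rightarrow>\<^sub>M borel" "\<And>i. i < l \<Longrightarrow> B i \<in> N \<rightarrow>\<^sub>M count_space UNIV"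
    and Z: "Z \<in> N \<rightarrow>\<^sub>M borel"
  shows "Measurable.pred N (\<lambda>\<omega>. pick (map (\<lambda>i. (X i \<omega>, Y i \<omega>)) [0..<k])
    (map (\<lambda>i. (W i \<omega>, B i \<omega>)) [0..<l]) (Z \<omega>) (Z \<omega>))"
proof -
  let ?M = "borel \<Otimes>\<^sub>M count_space UNIV :: ('a \<times> bool) measure"
  define s where "s \<omega> i = (if i < k then (X i \<omega>, Y i \<omega>) else undefined)" for \<omega> i
  define w where "w \<omega> i = (if i < l then (W i \<omega>, B i \<omega>) else undefined)" for \<omega> i
  have un: "(\<lambda>\<omega>. undefined) \<in> N \<rightarrow>\<^sub>M ?M" by (rule measurable_const) (simp add: space_pair_measure)
  have "s \<in> N \<rightarrow>\<^sub>M PiM UNIV (\<lambda>_. ?M)"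
  proof (rule measurable_PiM_single')
    show "(\<lambda>\<omega>. s \<omega> i) \<in> N \<rightarrow>\<^sub>M ?M" for i
      using un X[of i] by (cases "i < k") (simp_all add: s_def)
  qed (simp add: space_pair_measure)
  moreover have "w \<in> N \<rightarrow>\<^sub>M PiM UNIV (\<lambda>_. ?M)"
  proof (rule measurable_PiM_single')
    show "(\<lambda>\<omega>. w \<omega> i) \<in> N \<rightarrow>\<^sub>M ?M" for i
      using un W[of i] by (cases "i < l") (simp_all add: w_def)
  qed (simp add: space_pair_measure)
  ultimately have m: "(\<lambda>\<omega>. (s \<omega>, w \<omega>, Z \<omega>)) \<in> N \<rightarrow>\<^sub>M PiM UNIV (\<lambda>_::nat. ?M) \<Otimes>\<^sub>M PiM UNIV (\<lambda>_::nat. ?M) \<Otimes>\<^sub>M borel"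
    using Z by (intro measurable_Pair)
  have c: "(\<lambda>(s, w, x). pick (map s [0..<k]) (map w [0..<l]) x x)
        \<in> PiM UNIV (\<lambda>_::nat. ?M) \<Otimes>\<^sub>M PiM UNIV (\<lambda>_::nat. ?M) \<Otimes>\<^sub>M borel \<rightarrow>\<^sub>M count_space UNIV"
    using assms(1) unfolding valid_choice_rule_def by (elim conjE allE)
  have eq: "map (s \<omega>) [0..<k] = map (\<lambda>i. (X i \<omega>, Y i \<omega>)) [0..<k]"
    "map (w \<omega>) [0..<l] = map (\<lambda>i. (W i \<omega>, B i \<omega>)) [0..<l]" for \<omega>
    by (simp_all add: s_def w_def)
  show ?thesis
    using measurable_compose[OF m c] unfolding split_conv eq .
qed

lemma measurable_passive:
  assumes "passive_algorithm Ap"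
    and U: "U \<in> N \<rightarrow>\<^sub>M borel"
    and W: "\<And>i. i < l \<Longrightarrow> W i \<in> N \<rightarrow>\<^sub>M borel" "\<And>i. i < l \<Longrightarrow> B i \<in> N \<rightarrow>\<^sub>M count_space UNIV"
    and Z: "Z \<in> N \<rightarrow>\<^sub>M borel"
  shows "Measurable.pred N (\<lambda>\<omega>. Ap (U \<omega>) (map (\<lambda>i. (W i \<omega>, B i \<omega>)) [0..<l]) (Z \<omega>))"
proof -
  let ?M = "borel \<Otimes>\<^sub>M count_space UNIV :: ('a \<times> bool) measure"
  define w where "w \<omega> i = (if i < l then (W i \<omega>, B i \<omega>) else undefined)" for \<omega> i
  have un: "(\<lambda>\<omega>. undefined) \<in> N \<rightarrow>\<^sub>M ?M" by (rule measurable_const) (simp add: space_pair_measure)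
  have "w \<in> N \<rightarrow>\<^sub>M PiM UNIV (\<lambda>_. ?M)"
  proof (rule measurable_PiM_single')
    show "(\<lambda>\<omega>. w \<omega> i) \<in> N \<rightarrow>\<^sub>M ?M" for i
      using un W[of i] by (cases "i < l") (simp_all add: w_def)
  qed (simp add: space_pair_measure)
  then have m: "(\<lambda>\<omega>. (U \<omega>, w \<omega>, Z \<omega>)) \<in> N \<rightarrow>\<^sub>M borel \<Otimes>\<^sub>M PiM UNIV (\<lambda>_::nat. ?M) \<Otimes>\<^sub>M borel"
    using Z U by (intro measurable_Pair)
  have c: "(\<lambda>(u, z, x). Ap u (map z [0..<l]) x)
        \<in> borel \<Otimes>\<^sub>M PiM UNIV (\<lambda>_::nat. ?M) \<Otimes>\<^sub>M borel \<rightarrow>\<^sub>M count_space UNIV"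
    using assms(1) unfolding passive_algorithm_def by (elim allE)
  have eq: "map (w \<omega>) [0..<l] = map (\<lambda>i. (W i \<omega>, B i \<omega>)) [0..<l]" for \<omega>
    by (simp add: w_def)
  show ?thesis
    using measurable_compose[OF m c] unfolding split_conv eq .
qed

text \<open>For a fixed number of iterations the points of the sample are known in advance, so it
  remains to treat the labels and the request count. They are built by induction, since each guess
  may depend on the sample constructed so far.\<close>

lemma measurable_loop_labels:
  fixes X :: "'b \<Rightarrow> nat \<Rightarrow> 'a::topological_space" and n :: nat
  assumes C: "measurable_class C" and pick: "valid_choice_rule C pick"
    and X: "\<And>i. (\<lambda>\<omega>. X \<omega> i) \<in> N \<rightarrow>\<^sub>M borel"
    and Y: "\<And>i. (\<lambda>\<omega>. Y \<omega> i) \<in> N \<rightarrow>\<^sub>M count_space UNIV"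
  defines "S \<equiv> \<lambda>\<omega>. initial_sample n (X \<omega>) (Y \<omega>)"
  shows "\<exists>T B. T \<in> N \<rightarrow>\<^sub>M count_space UNIV \<and> (\<forall>i. B i \<in> N \<rightarrow>\<^sub>M count_space UNIV) \<and>
    (\<forall>\<omega>. foldl (loop_step (DIS (version_space C (S \<omega>))) (pick (S \<omega>)) n (X \<omega>) (Y \<omega>)) (n div 2, [])
        [n div 2..<n div 2 + j] =
      (T \<omega> :: nat, map (\<lambda>i. (X \<omega> (n div 2 + i), B i \<omega>)) [0..<j]))"
proof (induction j)
  case 0
  show ?case
    by (rule exI[of _ "\<lambda>_. n div 2"], rule exI[of _ "\<lambda>_ _. True"]) simp
next
  case (Suc j)
  define k where "k = n div 2"
  define D where "D \<omega> = DIS (version_space C (S \<omega>))" for \<omega>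
  obtain T B where T: "T \<in> N \<rightarrow>\<^sub>M count_space UNIV" and B: "\<And>i. B i \<in> N \<rightarrow>\<^sub>M count_space UNIV"
    and eq: "\<And>\<omega>. foldl (loop_step (D \<omega>) (pick (S \<omega>)) n (X \<omega>) (Y \<omega>)) (k, []) [k..<k + j] =
      (T \<omega>, map (\<lambda>i. (X \<omega> (k + i), B i \<omega>)) [0..<j])"
    using Suc unfolding k_def D_def by metis
  define L where "L \<omega> = map (\<lambda>i. (X \<omega> (k + i), B i \<omega>)) [0..<j]" for \<omega>
  define Q where "Q \<omega> \<longleftrightarrow> X \<omega> (k + j) \<in> D \<omega> \<and> T \<omega> < n" for \<omega>
  define b where "b \<omega> \<longleftrightarrow> (if Q \<omega> then Y \<omega> (k + j) else pick (S \<omega>) (L \<omega>) (X \<omega> (k + j)) (X \<omega> (k + j)))" for \<omega>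
  have [measurable]: "Measurable.pred N (\<lambda>\<omega>. X \<omega> (k + j) \<in> D \<omega>)"
    unfolding D_def S_def initial_sample_def by (rule measurable_mem_DIS[OF C]) (rule X Y)+
  have [measurable]: "Measurable.pred N (\<lambda>\<omega>. pick (S \<omega>) (L \<omega>) (X \<omega> (k + j)) (X \<omega> (k + j)))"
    unfolding L_def S_def initial_sample_def by (rule measurable_choice[OF pick]) (rule X Y B)+
  note [measurable] = T B Y
  have Q[measurable]: "Measurable.pred N Q"
    unfolding Q_def by measurable
  have b: "Measurable.pred N b"
    unfolding b_def by measurable
  show ?case
  proof (rule exI[of _ "\<lambda>\<omega>. if Q \<omega> then Suc (T \<omega>) else T \<omega>"],
      rule exI[of _ "\<lambda>i. if i < j then B i else b"], intro conjI allI)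
    show "(\<lambda>\<omega>. if Q \<omega> then Suc (T \<omega>) else T \<omega>) \<in> N \<rightarrow>\<^sub>M count_space UNIV"
      by measurable
    show "(if i < j then B i else b) \<in> N \<rightarrow>\<^sub>M count_space UNIV" for i
      using B b by simp
    fix \<omega>
    have "[k..<k + Suc j] = [k..<k + j] @ [k + j]" by simp
    then have "foldl (loop_step (D \<omega>) (pick (S \<omega>)) n (X \<omega>) (Y \<omega>)) (k, []) [k..<k + Suc j]
        = loop_step (D \<omega>) (pick (S \<omega>)) n (X \<omega>) (Y \<omega>) (T \<omega>, L \<omega>) (k + j)"
      by (simp add: eq L_def)
    also have "\<dots> = (if Q \<omega> then Suc (T \<omega>) else T \<omega>, L \<omega> @ [(X \<omega> (k + j), b \<omega>)])"
      by (simp add: loop_step_def Q_def b_def)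
    also have "L \<omega> @ [(X \<omega> (k + j), b \<omega>)] =
        map (\<lambda>i. (X \<omega> (k + i), (if i < j then B i else b) \<omega>)) [0..<Suc j]"
      by (simp add: L_def cong: map_cong)
    finally show "foldl (loop_step (DIS (version_space C (S \<omega>))) (pick (S \<omega>)) n (X \<omega>) (Y \<omega>)) (n div 2, [])
        [n div 2..<n div 2 + Suc j] =
      (if Q \<omega> then Suc (T \<omega>) else T \<omega>, map (\<lambda>i. (X \<omega> (n div 2 + i), (if i < j then B i else b) \<omega>)) [0..<Suc j])"
      unfolding k_def D_def .
  qed
qed

lemma measurable_estimate:
  assumes "\<And>i. Measurable.pred N (\<lambda>\<omega>. X \<omega> i \<in> D \<omega>)"
  shows "(\<lambda>\<omega>. estimate (D \<omega>) n (X \<omega>)) \<in> borel_measurable N"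
proof -
  have "(\<lambda>\<omega>. indicator (D \<omega>) (X \<omega> i) :: real) = (\<lambda>\<omega>. if X \<omega> i \<in> D \<omega> then 1 else 0)" for i
    by (simp add: indicator_def fun_eq_iff)
  then have [measurable]: "(\<lambda>\<omega>. indicator (D \<omega>) (X \<omega> i) :: real) \<in> borel_measurable N" for i
    using assms[of i] by simp
  show ?thesis
    unfolding estimate_def by measurable
qed

lemma measurable_loop_length:
  assumes "\<And>i. Measurable.pred N (\<lambda>\<omega>. X \<omega> i \<in> D \<omega>)"
  shows "(\<lambda>\<omega>. loop_length (D \<omega>) n (X \<omega>)) \<in> N \<rightarrow>\<^sub>M count_space UNIV"
proof -
  note [measurable] = measurable_estimate[OF assms, of n]
  show ?thesis
    unfolding loop_length_def by measurable
qed

lemma measurable_meta_algorithm_0: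
  fixes X :: "'b \<Rightarrow> nat \<Rightarrow> 'a::topological_space" and n :: nat
  assumes C: "measurable_class C" and pick: "valid_choice_rule C pick"
    and Ap: "passive_algorithm Ap"
    and U: "U \<in> N \<rightarrow>\<^sub>M borel"
    and X: "\<And>i. (\<lambda>\<omega>. X \<omega> i) \<in> N \<rightarrow>\<^sub>M borel"
    and Y: "\<And>i. (\<lambda>\<omega>. Y \<omega> i) \<in> N \<rightarrow>\<^sub>M count_space UNIV"
    and Z: "Z \<in> N \<rightarrow>\<^sub>M borel"
  shows "Measurable.pred N (\<lambda>\<omega>. run (Y \<omega>) (meta_algorithm_0 C pick Ap n (U \<omega>) (X \<omega>)) (Z \<omega>))"
proof -
  define S where "S \<omega> = initial_sample n (X \<omega>) (Y \<omega>)" for \<omega>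
  define D where "D \<omega> = DIS (version_space C (S \<omega>))" for \<omega>
  have D: "Measurable.pred N (\<lambda>\<omega>. X \<omega> i \<in> D \<omega>)" for i
    unfolding D_def S_def initial_sample_def by (rule measurable_mem_DIS[OF C]) (rule X Y)+
  let ?L = "\<lambda>j \<omega>. snd (foldl (loop_step (D \<omega>) (pick (S \<omega>)) n (X \<omega>) (Y \<omega>)) (n div 2, []) [n div 2..<n div 2 + j])"
  have "Measurable.pred N (\<lambda>\<omega>. Ap (U \<omega>) (?L j \<omega>) (Z \<omega>))" for j
  proof -
    obtain T B where B: "\<And>i. B i \<in> N \<rightarrow>\<^sub>M count_space UNIV"
      and eq: "\<And>\<omega>. foldl (loop_step (D \<omega>) (pick (S \<omega>)) n (X \<omega>) (Y \<omega>)) (n div 2, []) [n div 2..<n div 2 + j] =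
        (T \<omega>, map (\<lambda>i. (X \<omega> (n div 2 + i), B i \<omega>)) [0..<j])"
      using measurable_loop_labels[where X=X and Y=Y and n=n and j=j, OF C pick X Y] unfolding D_def S_def by metis
    show ?thesis
      unfolding eq snd_conv by (rule measurable_passive[OF Ap U _ _ Z]) (rule X B)+
  qed
  \<comment> \<open>The loop length is random but takes countably many values, so measurability for
    each fixed length is enough.\<close>
  then have "Measurable.pred N (\<lambda>\<omega>. Ap (U \<omega>) (?L (loop_length (D \<omega>) n (X \<omega>)) \<omega>) (Z \<omega>))"
    using measurable_loop_length[OF D, of n] by (rule measurable_compose_countable)
  then show ?thesis
    unfolding run_meta_algorithm_0 Let_def D_def S_def .
qed

lemma active_meta_algorithm_0:
  fixes C :: "'a::topological_space classifier set"
  assumes C: "measurable_class C" and pick: "valid_choice_rule C pick"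
  shows "active_meta_algorithm (meta_algorithm_0 C pick)"
  unfolding active_meta_algorithm_def active_algorithm_def
proof (intro allI impI conjI requests_meta_algorithm_0)
  fix Ap :: "'a passive_map" and n assume Ap: "passive_algorithm Ap"
  show "(\<lambda>(u, x, y, z). run y (meta_algorithm_0 C pick Ap n u x) z)
        \<in> borel \<Otimes>\<^sub>M PiM UNIV (\<lambda>_::nat. borel) \<Otimes>\<^sub>M PiM UNIV (\<lambda>_::nat. count_space UNIV) \<Otimes>\<^sub>M borel
          \<rightarrow>\<^sub>M count_space UNIV"
    unfolding split_beta'
    by (rule measurable_meta_algorithm_0[OF C pick Ap]) measurable
qed

subsection \<open>Risks\<close>

lemma prob_space_seed: "prob_space seed"
  unfolding seed_def by (rule prob_space_uniform_measure) auto

lemma sets_seed[measurable_cong]: "sets seed = sets borel"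
  by (simp add: seed_def)

lemma space_seed[simp]: "space seed = UNIV"
  by (simp add: seed_def)

context target_distribution
begin

lemma er_measurable:
  assumes G: "Measurable.pred (N \<Otimes>\<^sub>M P) (\<lambda>p. G (fst p) (snd p))"
  shows "(\<lambda>\<omega>. er P f (G \<omega>)) \<in> borel_measurable N"
proof -
  have "(\<lambda>p. f (snd p)) \<in> N \<Otimes>\<^sub>M P \<rightarrow>\<^sub>M count_space UNIV"
    by measurable
  with G have "Measurable.pred (N \<Otimes>\<^sub>M P) (\<lambda>p. G (fst p) (snd p) \<noteq> f (snd p))"
    by measurable
  then have "{p \<in> space (N \<Otimes>\<^sub>M P). G (fst p) (snd p) \<noteq> f (snd p)} \<in> sets (N \<Otimes>\<^sub>M P)"
    by (simp add: pred_def)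
  from measurable_emeasure_Pair[OF this]
  have "(\<lambda>\<omega>. enn2real (emeasure P (Pair \<omega> -` {p \<in> space (N \<Otimes>\<^sub>M P). G (fst p) (snd p) \<noteq> f (snd p)}))) \<in> borel_measurable N"
    by (rule borel_measurable_enn2real)
  then show ?thesis
    by (rule measurable_cong[THEN iffD1, rotated])
       (auto simp: er_def measure_def space_pair_measure vimage_def)
qed

lemma er_nonneg: "0 \<le> er P f h" and er_le_1: "er P f h \<le> 1"
  by (simp_all add: er_def)

text \<open>Tonelli with the seed inside: the inner integral is a function of the data sequence
  alone, which allows risks to be compared pointwise in the data.\<close>

lemma integral_er:
  assumes G: "Measurable.pred ((seed \<Otimes>\<^sub>M Seq) \<Otimes>\<^sub>M P) (\<lambda>p. G (fst (fst p)) (snd (fst p)) (snd p))"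
  shows "ennreal (LINT (u, x)|(seed \<Otimes>\<^sub>M Seq). er P f (G u x)) = (\<integral>\<^sup>+x. \<integral>\<^sup>+u. ennreal (er P f (G u x)) \<partial>seed \<partial>Seq)"
    and "(\<lambda>x. \<integral>\<^sup>+u. ennreal (er P f (G u x)) \<partial>seed) \<in> borel_measurable Seq"
proof -
  interpret seed: prob_space seed by (rule prob_space_seed)
  interpret pair_prob_space seed Seq ..
  have m: "(\<lambda>p. er P f (G (fst p) (snd p))) \<in> borel_measurable (seed \<Otimes>\<^sub>M Seq)"
    using G by (rule er_measurable)
  have "integrable (seed \<Otimes>\<^sub>M Seq) (\<lambda>p. er P f (G (fst p) (snd p)))"
    by (rule integrable_const_bound[of _ 1]) (auto simp: er_nonneg er_le_1 m)
  then have "ennreal (LINT p|(seed \<Otimes>\<^sub>M Seq). er P f (G (fst p) (snd p))) =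
      (\<integral>\<^sup>+p. ennreal (er P f (G (fst p) (snd p))) \<partial>(seed \<Otimes>\<^sub>M Seq))"
    by (intro nn_integral_eq_integral[symmetric]) (auto simp: er_nonneg)
  also have "\<dots> = (\<integral>\<^sup>+x. \<integral>\<^sup>+u. ennreal (er P f (G u x)) \<partial>seed \<partial>Seq)"
    using m by (subst nn_integral_snd[symmetric]) (auto simp: split_beta')
  finally show "ennreal (LINT (u, x)|(seed \<Otimes>\<^sub>M Seq). er P f (G u x)) = (\<integral>\<^sup>+x. \<integral>\<^sup>+u. ennreal (er P f (G u x)) \<partial>seed \<partial>Seq)"
    by (simp add: split_beta')
  have "(\<lambda>p. ennreal (er P f (G (snd p) (fst p)))) \<in> borel_measurable (Seq \<Otimes>\<^sub>M seed)"
    using measurable_compose[OF measurable_pair_swap' m] by (simp add: split_beta')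
  then have "(\<lambda>x. \<integral>\<^sup>+u. ennreal (er P f (G (snd (x, u)) (fst (x, u)))) \<partial>seed) \<in> borel_measurable Seq"
    by (rule seed.borel_measurable_nn_integral_fst)
  then show "(\<lambda>x. \<integral>\<^sup>+u. ennreal (er P f (G u x)) \<partial>seed) \<in> borel_measurable Seq" by simp
qed

lemma nn_integral_er_le_1: "(\<integral>\<^sup>+u. ennreal (er P f (G u)) \<partial>seed) \<le> 1"
proof -
  interpret seed: prob_space seed by (rule prob_space_seed)
  have "(\<integral>\<^sup>+u. ennreal (er P f (G u)) \<partial>seed) \<le> (\<integral>\<^sup>+u. 1 \<partial>seed)"
    by (intro nn_integral_mono) (simp add: er_le_1)
  also have "\<dots> = 1" using seed.emeasure_space_1 by simp
  finally show ?thesis .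
qed

definition true_sample :: "nat \<Rightarrow> (nat \<Rightarrow> 'a) \<Rightarrow> 'a sample" where
  "true_sample m w = map (\<lambda>i. (w i, f (w i))) [0..<m]"

definition sample_risk :: "'a passive_map \<Rightarrow> nat \<Rightarrow> (nat \<Rightarrow> 'a) \<Rightarrow> ennreal" where
  "sample_risk Ap m w = (\<integral>\<^sup>+u. ennreal (er P f (Ap u (true_sample m w))) \<partial>seed)"

lemma passive_risk_eq:
  assumes Ap: "passive_algorithm Ap"
  shows "ennreal (passive_risk Ap f P m) = (\<integral>\<^sup>+w. sample_risk Ap m w \<partial>Seq)"
    and "sample_risk Ap m \<in> borel_measurable Seq"
proof -
  have "Measurable.pred ((seed \<Otimes>\<^sub>M Seq) \<Otimes>\<^sub>M P)
      (\<lambda>p. Ap (fst (fst p)) (map (\<lambda>i. (snd (fst p) i, f (snd (fst p) i))) [0..<m]) (snd p))"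
    by (rule measurable_passive[OF Ap]) measurable
  from integral_er[OF this]
  show "ennreal (passive_risk Ap f P m) = (\<integral>\<^sup>+w. sample_risk Ap m w \<partial>Seq)"
    and "sample_risk Ap m \<in> borel_measurable Seq"
    by (simp_all add: passive_risk_def sample_risk_def[abs_def] true_sample_def)
qed

definition meta_risk :: "'a choice_rule \<Rightarrow> 'a passive_map \<Rightarrow> nat \<Rightarrow> (nat \<Rightarrow> 'a) \<Rightarrow> ennreal" where
  "meta_risk pick Ap n x =
     (\<integral>\<^sup>+u. ennreal (er P f (run (\<lambda>i. f (x i)) (meta_algorithm_0 C pick Ap n u x))) \<partial>seed)"

lemma active_risk_eq:
  assumes Ap: "passive_algorithm Ap" and pick: "valid_choice_rule C pick"
  shows "ennreal (active_risk (meta_algorithm_0 C pick Ap) f P n) = (\<integral>\<^sup>+x. meta_risk pick Ap n x \<partial>Seq)"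
    and "meta_risk pick Ap n \<in> borel_measurable Seq"
proof -
  have "Measurable.pred ((seed \<Otimes>\<^sub>M Seq) \<Otimes>\<^sub>M P) (\<lambda>p.
      run (\<lambda>i. f (snd (fst p) i)) (meta_algorithm_0 C pick Ap n (fst (fst p)) (snd (fst p))) (snd p))"
    by (rule measurable_meta_algorithm_0[OF meas pick Ap]) measurable
  from integral_er[OF this]
  show "ennreal (active_risk (meta_algorithm_0 C pick Ap) f P n) = (\<integral>\<^sup>+x. meta_risk pick Ap n x \<partial>Seq)"
    and "meta_risk pick Ap n \<in> borel_measurable Seq"
    by (simp_all add: active_risk_def meta_risk_def[abs_def])
qed

lemma version_space_initial_sample:
  "version_space C (initial_sample n x (\<lambda>i. f (x i))) = V (n div 2) x"
  by (simp add: V_def initial_sample_def)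

lemma V_comb_seq: "V k (comb_seq k s w) = V k s"
  by (simp add: V_eq comb_seq_less)

end

text \<open>The invariant is that \<open>t - k\<close> counts the points of \<open>D\<close> met so
  far. By \<open>few\<close> the budget still has room whenever a point of \<open>D\<close> arrives,
  and outside \<open>D\<close> the guess is correct.\<close>

lemma loop_correct:
  fixes x :: "nat \<Rightarrow> 'a"
  assumes guess: "\<And>L z. z \<notin> D \<Longrightarrow> g L z z = f z"
    and few: "card {i. i < N \<and> x (k + i) \<in> D} \<le> n - k"
  shows "snd (foldl (loop_step D g n x (\<lambda>i. f (x i))) (k, []) [k..<k + N]) =
    map (\<lambda>i. (x (k + i), f (x (k + i)))) [0..<N]"
proof -
  have "foldl (loop_step D g n x (\<lambda>i. f (x i))) (k, []) [k..<k + j] =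
    (k + card {i. i < j \<and> x (k + i) \<in> D}, map (\<lambda>i. (x (k + i), f (x (k + i)))) [0..<j])" if "j \<le> N" for j
    using that
  proof (induction j)
    case (Suc j)
    let ?c = "\<lambda>j. {i. i < j \<and> x (k + i) \<in> D}"
    have IH: "foldl (loop_step D g n x (\<lambda>i. f (x i))) (k, []) [k..<k + j] =
      (k + card (?c j), map (\<lambda>i. (x (k + i), f (x (k + i)))) [0..<j])"
      using Suc by simp
    have "[k..<k + Suc j] = [k..<k + j] @ [k + j]" by simp
    then have *: "foldl (loop_step D g n x (\<lambda>i. f (x i))) (k, []) [k..<k + Suc j] =
      loop_step D g n x (\<lambda>i. f (x i)) (k + card (?c j), map (\<lambda>i. (x (k + i), f (x (k + i)))) [0..<j]) (k + j)"
      by (simp add: IH)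
    show ?case
    proof (cases "x (k + j) \<in> D")
      case True
      then have c: "?c (Suc j) = insert j (?c j)" by (auto simp: less_Suc_eq)
      then have card: "card (?c (Suc j)) = Suc (card (?c j))" by simp
      have "card (?c (Suc j)) \<le> card (?c N)"
        using Suc.prems by (intro card_mono) auto
      then have "k + card (?c j) < n" using few card by linarith
      then show ?thesis unfolding * using True by (simp add: loop_step_def card)
    next
      case False
      then have c: "?c (Suc j) = ?c j" by (auto simp: less_Suc_eq)
      show ?thesis unfolding * c using False by (simp add: loop_step_def guess)
    qed
  qed simp
  then show ?thesis by simp
qed

text \<open>
  The data sequence is split as \<open>comb_seq k s (comb_seq (n\<^sup>2 - k) w v)\<close> with \<open>k = n div 2\<close>: \<open>s\<close> determines
  the version space, \<open>v\<close> the estimate, and the loop only reads \<open>w\<close>, since it stops before index \<open>n\<^sup>2\<close>.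
  Thus the length of the loop is independent of the points it processes.
\<close>

definition tail_estimate :: "'a set \<Rightarrow> nat \<Rightarrow> (nat \<Rightarrow> 'a) \<Rightarrow> real" where
  "tail_estimate D n v = max (2 / (real n)\<^sup>2 * real (card {i. i < n\<^sup>2 \<and> v i \<in> D})) (4 / real n)"

definition tail_length :: "'a set \<Rightarrow> nat \<Rightarrow> (nat \<Rightarrow> 'a) \<Rightarrow> nat" where
  "tail_length D n v = nat \<lfloor>real n / (4 * tail_estimate D n v)\<rfloor>"

lemma half_le_square: "n div 2 \<le> (n::nat)\<^sup>2"
proof -
  have "n \<le> n\<^sup>2" by (cases n) (auto simp: power2_eq_square)
  then show ?thesis by linarith
qed

lemma estimate_comb_seq:
  "estimate D n (comb_seq (n div 2) s (comb_seq (n\<^sup>2 - n div 2) w v)) = tail_estimate D n v"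
proof -
  let ?x = "comb_seq (n div 2) s (comb_seq (n\<^sup>2 - n div 2) w v)"
  have x: "?x (n\<^sup>2 + i) = v i" for i
  proof -
    have "\<not> n\<^sup>2 + i - n div 2 < n\<^sup>2 - n div 2" "n\<^sup>2 + i - n div 2 - (n\<^sup>2 - n div 2) = i"
      "\<not> n\<^sup>2 + i < n div 2"
      using half_le_square[of n] by linarith+
    then show ?thesis by (simp only: comb_seq_def if_False)
  qed
  have "(\<Sum>i\<in>{n\<^sup>2..<2 * n\<^sup>2}. indicator D (?x i)) = (\<Sum>i\<in>{0..<n\<^sup>2}. indicator D (?x (n\<^sup>2 + i)) :: real)"
    using sum.shift_bounds_nat_ivl[of "\<lambda>i. indicator D (?x i)" 0 "n\<^sup>2" "n\<^sup>2"]
    by (simp add: add.commute mult_2)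
  also have "\<dots> = real (card {i. i < n\<^sup>2 \<and> v i \<in> D})"
    by (simp add: x indicator_def sum.If_cases lessThan_def Collect_conj_eq atLeast0LessThan)
  finally show ?thesis
    by (simp add: estimate_def tail_estimate_def)
qed

lemma loop_length_comb_seq:
  "loop_length D n (comb_seq (n div 2) s (comb_seq (n\<^sup>2 - n div 2) w v)) = tail_length D n v"
  by (simp add: loop_length_def tail_length_def estimate_comb_seq)

text \<open>The floor \<open>4 / real n\<close> of the estimate caps the loop at
  \<open>(real n)\<^sup>2 / 16\<close> points, so it ends before the block used for
  estimation.\<close>

lemma tail_length_le: "n div 2 + tail_length D n v \<le> n\<^sup>2"
proof (cases "n = 0")
  case False
  have "0 \<le> tail_estimate D n v" by (simp add: tail_estimate_def le_max_iff_disj)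
  then have "real (tail_length D n v) \<le> real n / (4 * tail_estimate D n v)"
    unfolding tail_length_def by (intro of_nat_floor) simp
  also have "\<dots> \<le> real n / (4 * (4 / real n))"
    using False by (intro divide_left_mono mult_left_mono mult_pos_pos) (auto simp: tail_estimate_def less_max_iff_disj)
  also have "\<dots> = (real n)\<^sup>2 / 16" by (simp add: power2_eq_square)
  finally have "real (tail_length D n v) \<le> (real n)\<^sup>2 / 16" .
  moreover have "real (n div 2) \<le> real n / 2" by linarith
  moreover have "real n \<le> (real n)\<^sup>2" using False by (simp add: power2_eq_square)
  ultimately have "real (n div 2 + tail_length D n v) \<le> (real n)\<^sup>2"
    unfolding of_nat_add by linarith
  then show ?thesis by (metis of_nat_le_iff of_nat_power)
qed (simp add: tail_length_def)

context target_distribution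
begin

text \<open>If fewer than \<open>real n / 2\<close> loop points fall into the region of
  disagreement, the budget suffices and the learner sees the true sample. Otherwise the indicator
  charges the trivial bound 1.\<close>

lemma meta_risk_le:
  assumes pick: "valid_choice_rule C pick"
  fixes n :: nat
  defines "k \<equiv> n div 2"
  defines "x \<equiv> \<lambda>s w v. comb_seq k s (comb_seq (n\<^sup>2 - k) w v)"
  defines "N \<equiv> \<lambda>s. tail_length (DIS (V k s)) n"
  shows "meta_risk pick Ap n (x s w v) \<le> sample_risk Ap (N s v) w +
      indicator {w. real n / 2 \<le> real (card {i. i < N s v \<and> w i \<in> DIS (V k s)})} w"
proof (cases "real n / 2 \<le> real (card {i. i < N s v \<and> w i \<in> DIS (V k s)})")
  case True
  then show ?thesis
    unfolding meta_risk_def by (simp add: indicator_def) (rule order_trans[OF nn_integral_er_le_1], simp)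
next
  case False
  define X where "X = x s w v"
  have vs: "version_space C (initial_sample n X (\<lambda>i. f (X i))) = V k s"
    unfolding version_space_initial_sample X_def x_def k_def V_comb_seq ..
  have len: "loop_length (DIS (V k s)) n X = N s v"
    unfolding X_def x_def k_def N_def loop_length_comb_seq ..
  have shift: "X (k + i) = w i" if "i < N s v" for i
  proof -
    have "i < n\<^sup>2 - k"
      using that tail_length_le[of n "DIS (V k s)" v] unfolding N_def k_def by linarith
    then show ?thesis by (simp add: X_def x_def comb_seq_def)
  qed
  \<comment> \<open>Since \<open>f\<close> belongs to the version space, a wrong guess at
    \<open>z\<close> would itself exhibit a disagreement at \<open>z\<close>.\<close>
  have guess: "pick (initial_sample n X (\<lambda>i. f (X i))) L z z = f z" if "z \<notin> DIS (V k s)" for L z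
  proof (rule ccontr)
    assume ne: "\<not> ?thesis"
    have "pick (initial_sample n X (\<lambda>i. f (X i))) L z \<in> V k s"
      using pick f_in_V[of k s] unfolding valid_choice_rule_def vs[symmetric] by blast
    then have "z \<in> DIS (V k s)"
      using f_in_V[of k s] ne by (rule DIS_I)
    then show False using that by simp
  qed
  have eq: "{i. i < N s v \<and> X (k + i) \<in> DIS (V k s)} = {i. i < N s v \<and> w i \<in> DIS (V k s)}"
    by (intro Collect_cong conj_cong refl) (simp add: shift)
  have few: "card {i. i < N s v \<and> X (k + i) \<in> DIS (V k s)} \<le> n - k"
    unfolding eq using False unfolding k_def by linarith
  have "run (\<lambda>i. f (X i)) (meta_algorithm_0 C pick Ap n u X) = Ap u (true_sample (N s v) w)" for u
  proof -
    have "run (\<lambda>i. f (X i)) (meta_algorithm_0 C pick Ap n u X) =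
        Ap u (map (\<lambda>i. (X (k + i), f (X (k + i)))) [0..<N s v])"
      unfolding run_meta_algorithm_0 Let_def vs len
      using loop_correct[where g="pick (initial_sample n X (\<lambda>i. f (X i)))" and f=f, OF guess few]
      by (simp add: k_def)
    also have "map (\<lambda>i. (X (k + i), f (X (k + i)))) [0..<N s v] = true_sample (N s v) w"
      by (simp add: true_sample_def shift)
    finally show ?thesis .
  qed
  then show ?thesis
    unfolding X_def[symmetric] by (simp add: sample_risk_def meta_risk_def)
qed


section \<open>Integration over the blocks of the data\<close>

lemma tail_estimate_measurable:
  assumes [measurable]: "D \<in> sets P"
  shows "tail_estimate D n \<in> borel_measurable Seq"
  unfolding tail_estimate_def[abs_def] by measurable

lemma tail_length_measurable:
  assumes "D \<in> sets P"
  shows "tail_length D n \<in> Seq \<rightarrow>\<^sub>M count_space UNIV"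
proof -
  note [measurable] = tail_estimate_measurable[OF assms, of n]
  show ?thesis unfolding tail_length_def[abs_def] by measurable
qed

definition crowded :: "'a set \<Rightarrow> nat \<Rightarrow> nat \<Rightarrow> (nat \<Rightarrow> 'a) set" where
  "crowded D n m = {w. real n / 2 \<le> real (card {i. i < m \<and> w i \<in> D})}"

lemma sets_crowded:
  assumes [measurable]: "D \<in> sets P"
  shows "crowded D n m \<in> sets Seq"
proof -
  have "{w \<in> space Seq. real n / 2 \<le> real (card {i. i < m \<and> w i \<in> D})} \<in> sets Seq" by measurable
  then show ?thesis by (simp add: crowded_def)
qed

text \<open>With \<open>v\<close> integrated last, the loop length is constant in the integral over
  \<open>w\<close>, which then equals the passive risk at that length plus the probability of
  crowding.\<close>

lemma integrate_loop_points:
  assumes Ap: "passive_algorithm Ap" and D: "D \<in> sets P"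
  shows "(\<integral>\<^sup>+w. \<integral>\<^sup>+v. sample_risk Ap (tail_length D n v) w + indicator (crowded D n (tail_length D n v)) w \<partial>Seq \<partial>Seq)
    = (\<integral>\<^sup>+v. ennreal (passive_risk Ap f P (tail_length D n v)) + emeasure Seq (crowded D n (tail_length D n v)) \<partial>Seq)"
proof -
  interpret pair_sigma_finite Seq Seq ..
  let ?g = "\<lambda>m w. sample_risk Ap m w + indicator (crowded D n m) w"
  have g: "?g m \<in> borel_measurable Seq" for m
    using passive_risk_eq(2)[OF Ap, of m] sets_crowded[OF D, of n m] by measurable
  have "(\<lambda>p. ?g m (fst p)) \<in> borel_measurable (Seq \<Otimes>\<^sub>M Seq)" for m
    by (rule measurable_compose[OF measurable_fst g])
  then have "(\<lambda>p. ?g (tail_length D n (snd p)) (fst p)) \<in> borel_measurable (Seq \<Otimes>\<^sub>M Seq)"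
    by (rule measurable_compose_countable) (rule measurable_compose[OF measurable_snd tail_length_measurable[OF D]])
  then have "(\<integral>\<^sup>+w. \<integral>\<^sup>+v. ?g (tail_length D n v) w \<partial>Seq \<partial>Seq) = (\<integral>\<^sup>+v. \<integral>\<^sup>+w. ?g (tail_length D n v) w \<partial>Seq \<partial>Seq)"
    by (intro Fubini'[symmetric]) (simp add: split_beta')
  also have "\<dots> = (\<integral>\<^sup>+v. ennreal (passive_risk Ap f P (tail_length D n v)) + emeasure Seq (crowded D n (tail_length D n v)) \<partial>Seq)"
    by (intro nn_integral_cong, subst nn_integral_add)
       (simp_all add: passive_risk_eq[OF Ap] sets_crowded[OF D] borel_measurable_indicator)
  finally show ?thesis .
qed

lemma passive_risk_le_1:
  assumes Ap: "passive_algorithm Ap"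
  shows "ennreal (passive_risk Ap f P m) \<le> 1"
proof -
  have "(\<integral>\<^sup>+w. sample_risk Ap m w \<partial>Seq) \<le> (\<integral>\<^sup>+w. 1 \<partial>Seq)"
    unfolding sample_risk_def by (intro nn_integral_mono nn_integral_er_le_1)
  then show ?thesis
    using Seq.emeasure_space_1 by (simp add: passive_risk_eq(1)[OF Ap])
qed

text \<open>Since \<open>4 / real n \<le> \<tau>\<close>, only the empirical term can exceed
  \<open>\<tau>\<close>, and then the count is at least twice the bound \<open>b\<close> on its
  mean. The rate in \<open>n\<^sup>2\<close> is weakened to one in \<open>n\<close>.\<close>

lemma tail_estimate_upper:
  assumes D: "D \<in> sets P" and n: "n > 0" and \<tau>: "4 / real n \<le> \<tau>" "prob D \<le> \<tau> / 4"
  shows "emeasure Seq {v. \<tau> < tail_estimate D n v} \<le> ennreal (exp (- (\<tau> / 16) * real n))"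
proof -
  define b where "b = (real n)\<^sup>2 * \<tau> / 4"
  let ?E = "{v \<in> space Seq. 2 * b \<le> real (card {i. i < n\<^sup>2 \<and> v i \<in> D})}"
  have "{v. \<tau> < tail_estimate D n v} \<subseteq> ?E"
  proof
    fix v assume "v \<in> {v. \<tau> < tail_estimate D n v}"
    then have "\<tau> < 2 / (real n)\<^sup>2 * real (card {i. i < n\<^sup>2 \<and> v i \<in> D})"
      using \<tau>(1) by (auto simp: tail_estimate_def)
    then show "v \<in> ?E" using n by (simp add: b_def field_simps)
  qed
  moreover have "?E \<in> sets Seq" using D by measurable
  ultimately have "emeasure Seq {v. \<tau> < tail_estimate D n v} \<le> emeasure Seq ?E"
    by (rule emeasure_mono)
  also have "\<dots> \<le> ennreal (exp (- b / 4))"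
  proof (rule chernoff_upper[OF D])
    have "(real n)\<^sup>2 * prob D \<le> (real n)\<^sup>2 * (\<tau> / 4)" by (intro mult_left_mono \<tau>) simp
    then show "real (n\<^sup>2) * prob D \<le> b" by (simp add: b_def)
  qed
  also have "\<dots> \<le> ennreal (exp (- (\<tau> / 16) * real n))"
  proof (intro ennreal_leI, subst exp_le_cancel_iff)
    have "0 \<le> \<tau>" using \<tau>(1) n by (meson divide_nonneg_nonneg of_nat_0_le_iff order_trans zero_le_numeral)
    moreover have "real n \<le> (real n)\<^sup>2" using n by (simp add: power2_eq_square)
    ultimately have "\<tau> / 16 * real n \<le> \<tau> / 16 * (real n)\<^sup>2" by (intro mult_left_mono) auto
    then show "- b / 4 \<le> - (\<tau> / 16) * real n" by (simp add: b_def mult.commute)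
  qed
  finally show ?thesis .
qed

text \<open>If \<open>prob D \<le> 4 / real n\<close>, the floor of the estimate excludes the event.
  Otherwise the count is below half its mean, and that mean is at least \<open>4 * real n\<close>,
  whence the rate \<open>2 / 5\<close>.\<close>

lemma tail_estimate_lower:
  assumes D: "D \<in> sets P" and n: "n > 0"
  shows "emeasure Seq {v. tail_estimate D n v < prob D} \<le> ennreal (exp (- (2 / 5) * real n))"
proof (cases "prob D \<le> 4 / real n")
  case True
  then have "{v. tail_estimate D n v < prob D} = {}"
    by (auto simp: tail_estimate_def)
  then show ?thesis by simp
next
  case False
  let ?E = "{v \<in> space Seq. real (card {i. i < n\<^sup>2 \<and> v i \<in> D}) \<le> real (n\<^sup>2) * prob D / 2}"
  have "{v. tail_estimate D n v < prob D} \<subseteq> ?E"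
  proof
    fix v assume "v \<in> {v. tail_estimate D n v < prob D}"
    then have "2 / (real n)\<^sup>2 * real (card {i. i < n\<^sup>2 \<and> v i \<in> D}) < prob D"
      by (auto simp: tail_estimate_def)
    then show "v \<in> ?E" using n by (simp add: field_simps)
  qed
  moreover have "?E \<in> sets Seq" using D by measurable
  ultimately have "emeasure Seq {v. tail_estimate D n v < prob D} \<le> emeasure Seq ?E"
    by (rule emeasure_mono)
  also have "\<dots> \<le> ennreal (exp (- real (n\<^sup>2) * prob D / 10))"
    by (rule chernoff_lower[OF D])
  also have "\<dots> \<le> ennreal (exp (- (2 / 5) * real n))"
  proof (intro ennreal_leI, subst exp_le_cancel_iff)
    have "(real n)\<^sup>2 * (4 / real n) \<le> (real n)\<^sup>2 * prob D" using False by (intro mult_left_mono) auto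
    then have "4 * real n \<le> (real n)\<^sup>2 * prob D" using n by (simp add: power2_eq_square)
    then show "- real (n\<^sup>2) * prob D / 10 \<le> - (2 / 5) * real n" by simp
  qed
  finally show ?thesis .
qed

text \<open>The mean number of hits in the loop is at most \<open>real n / 4\<close>, so crowding
  means at least twice that bound.\<close>

lemma emeasure_crowded:
  assumes D: "D \<in> sets P" and n: "n > 0" and q: "prob D \<le> tail_estimate D n v"
  shows "emeasure Seq (crowded D n (tail_length D n v)) \<le> ennreal (exp (- (1 / 16) * real n))"
proof -
  let ?N = "tail_length D n v"
  have pos: "0 < tail_estimate D n v" using n by (simp add: tail_estimate_def less_max_iff_disj)
  have "real ?N \<le> real n / (4 * tail_estimate D n v)"
    unfolding tail_length_def using pos by (intro of_nat_floor) simp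
  then have "real ?N * prob D \<le> real n / (4 * tail_estimate D n v) * tail_estimate D n v"
    using q pos by (intro mult_mono) auto
  then have "real ?N * prob D \<le> real n / 4" using pos by simp
  from chernoff_upper[OF D this] show ?thesis
    by (simp add: crowded_def)
qed

text \<open>The estimate gives a length of \<open>2 * K * real n\<close> before rounding; the spare
  \<open>K * real n \<ge> 1\<close> pays for the floor.\<close>

lemma tail_length_ge:
  assumes K: "K > 0" and n: "n > 0" "1 \<le> K * real n" and e: "tail_estimate D n v \<le> 1 / (8 * K)"
  shows "K * real n \<le> real (tail_length D n v)"
proof -
  have pos: "0 < tail_estimate D n v" using n by (simp add: tail_estimate_def less_max_iff_disj)
  have "2 * K * real n = real n / (4 * (1 / (8 * K)))" using K by simp
  also have "\<dots> \<le> real n / (4 * tail_estimate D n v)"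
    using e pos K by (intro divide_left_mono mult_left_mono mult_pos_pos) auto
  finally have "2 * K * real n \<le> real n / (4 * tail_estimate D n v)" .
  then have "2 * K * real n - 1 \<le> real (tail_length D n v)"
    unfolding tail_length_def by linarith
  then show ?thesis using n by linarith
qed

lemma estimation_bound:
  assumes Ap: "passive_algorithm Ap" and D: "D \<in> sets P"
    and K: "K > 0" and n: "n > 0" "1 \<le> K * real n" "4 / real n \<le> 1 / (8 * K)"
    and q: "prob D \<le> 1 / (8 * K) / 4" and \<epsilon>: "\<epsilon> \<ge> 0"
    and risk: "\<And>m. K * real n \<le> real m \<Longrightarrow> passive_risk Ap f P m \<le> \<epsilon>"
  shows "(\<integral>\<^sup>+v. ennreal (passive_risk Ap f P (tail_length D n v)) + emeasure Seq (crowded D n (tail_length D n v)) \<partial>Seq)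
    \<le> ennreal (\<epsilon> + exp (- (1 / 16) * real n) + 2 * (exp (- (1 / (8 * K) / 16) * real n) + exp (- (2 / 5) * real n)))"
proof -
  let ?\<tau> = "1 / (8 * K)"
  let ?A = "{v. ?\<tau> < tail_estimate D n v}"
  let ?B = "{v. tail_estimate D n v < prob D}"
  let ?J = "\<lambda>v. ennreal (passive_risk Ap f P (tail_length D n v)) + emeasure Seq (crowded D n (tail_length D n v))"
  note [measurable] = tail_estimate_measurable[OF D, of n]
  have "{v \<in> space Seq. ?\<tau> < tail_estimate D n v} \<in> sets Seq"
    "{v \<in> space Seq. tail_estimate D n v < prob D} \<in> sets Seq" by measurable
  then have AB[measurable]: "?A \<in> sets Seq" "?B \<in> sets Seq" by simp_all
  have "?J v \<le> ennreal (\<epsilon> + exp (- (1 / 16) * real n)) + 2 * (indicator ?A v + indicator ?B v)" for v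
  proof (cases "v \<in> ?A \<union> ?B")
    case True
    \<comment> \<open>On a bad event the integrand is a risk plus a probability, hence at most
      2.\<close>
    have "?J v \<le> 1 + 1"
      by (intro add_mono passive_risk_le_1[OF Ap] Seq.emeasure_le_1)
    also have "1 + 1 \<le> 2 * (indicator ?A v + indicator ?B v :: ennreal)"
      using True by (auto simp: indicator_def one_add_one mult_2[symmetric])
    finally show ?thesis by (rule order_trans) simp
  next
    case False
    then have "passive_risk Ap f P (tail_length D n v) \<le> \<epsilon>"
      by (intro risk tail_length_ge[OF K n(1,2)]) auto
    moreover have "emeasure Seq (crowded D n (tail_length D n v)) \<le> ennreal (exp (- (1 / 16) * real n))"
      using False by (intro emeasure_crowded[OF D n(1)]) auto
    ultimately have "?J v \<le> ennreal \<epsilon> + ennreal (exp (- (1 / 16) * real n))"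
      by (intro add_mono ennreal_leI)
    then show ?thesis using False \<epsilon> by (simp add: ennreal_plus)
  qed
  then have "(\<integral>\<^sup>+v. ?J v \<partial>Seq) \<le>
      (\<integral>\<^sup>+v. ennreal (\<epsilon> + exp (- (1 / 16) * real n)) + 2 * (indicator ?A v + indicator ?B v) \<partial>Seq)"
    by (rule nn_integral_mono)
  also have "\<dots> = ennreal (\<epsilon> + exp (- (1 / 16) * real n)) + 2 * (emeasure Seq ?A + emeasure Seq ?B)"
    using Seq.emeasure_space_1 AB by (simp add: nn_integral_add nn_integral_cmult)
  also have "\<dots> \<le> ennreal (\<epsilon> + exp (- (1 / 16) * real n)) +
      2 * (ennreal (exp (- (?\<tau> / 16) * real n)) + ennreal (exp (- (2 / 5) * real n)))"
    by (intro add_mono mult_left_mono tail_estimate_upper[OF D n(1) n(3) q] tail_estimate_lower[OF D n(1)]) auto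
  also have "\<dots> = ennreal (\<epsilon> + exp (- (1 / 16) * real n) + 2 * (exp (- (?\<tau> / 16) * real n) + exp (- (2 / 5) * real n)))"
  proof -
    have "2 * (ennreal a + ennreal b) = ennreal (2 * (a + b))" if "0 \<le> a" "0 \<le> b" for a b
      using that by (simp add: ennreal_mult)
    then show ?thesis using \<epsilon> by (simp add: ennreal_plus[symmetric] del: ennreal_plus)
  qed
  finally show ?thesis .
qed

section \<open>Upper bound on the active risk\<close>

lemma active_risk_split:
  assumes Ap: "passive_algorithm Ap" and pick: "valid_choice_rule C pick"
  shows "ennreal (active_risk (meta_algorithm_0 C pick Ap) f P n) =
      (\<integral>\<^sup>+s. \<integral>\<^sup>+w. \<integral>\<^sup>+v. meta_risk pick Ap n (comb_seq k s (comb_seq (n\<^sup>2 - k) w v)) \<partial>Seq \<partial>Seq \<partial>Seq)"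
proof -
  note [measurable] = active_risk_eq(2)[OF Ap pick, of n]
  have "(\<lambda>y. meta_risk pick Ap n (comb_seq k s y)) \<in> borel_measurable Seq" for s
    by measurable
  then have "(\<integral>\<^sup>+w. meta_risk pick Ap n (comb_seq k s w) \<partial>Seq) =
      (\<integral>\<^sup>+w. \<integral>\<^sup>+v. meta_risk pick Ap n (comb_seq k s (comb_seq (n\<^sup>2 - k) w v)) \<partial>Seq \<partial>Seq)" for s
    by (rule nn_integral_comb_seq)
  then show ?thesis
    unfolding active_risk_eq(1)[OF Ap pick]
    by (subst nn_integral_comb_seq[of _ k]) (simp_all add: active_risk_eq(2)[OF Ap pick])
qed

text \<open>The rate and the threshold are fixed before \<open>\<epsilon>\<close>, because later
  \<open>\<epsilon>\<close> tends to 0 while \<open>n\<close> grows.\<close>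

lemma active_risk_upper:
  assumes Ap: "passive_algorithm Ap" and pick: "valid_choice_rule C pick"
    and core: "prob (disagreement_core C P f) = 0" and K: "K > 0"
  shows "\<exists>c>0. \<exists>n0. \<forall>n\<ge>n0. \<forall>\<epsilon>\<ge>0. (\<forall>m. K * real n \<le> real m \<longrightarrow> passive_risk Ap f P m \<le> \<epsilon>) \<longrightarrow>
    active_risk (meta_algorithm_0 C pick Ap) f P n \<le> \<epsilon> + 7 * exp (- c * real n)"
proof -
  let ?\<tau> = "1 / (8 * K)"
  obtain c m0 where c: "c > 0" and m0: "\<And>m. m \<ge> m0 \<Longrightarrow>
      emeasure Seq {s. ?\<tau> / 4 < prob (DIS (V m s))} \<le> ennreal (exp (- c * real m))"
    using prob_DIS_V_large[OF core, of "?\<tau> / 4"] K by auto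
  \<comment> \<open>A common rate for all failures; \<open>c / 3\<close> appears because
    \<open>n div 2\<close> is at least \<open>n / 3\<close> from \<open>n = 3\<close> on. The factor
    7 adds up one term for crowding, four for the two deviations of the estimate and two for a large
    region of disagreement.\<close>
  define c' where "c' = min (1 / 16) (min (?\<tau> / 16) (c / 3))"
  have c': "c' > 0" "c' \<le> 1 / 16" "c' \<le> ?\<tau> / 16" "c' \<le> c / 3" using c K by (auto simp: c'_def)
  define n0 where "n0 = max (max 3 (2 * m0)) (nat \<lceil>max (1 / K) (32 * K)\<rceil>)"
  have "active_risk (meta_algorithm_0 C pick Ap) f P n \<le> \<epsilon> + 7 * exp (- c' * real n)"
    if n: "n \<ge> n0" and \<epsilon>: "\<epsilon> \<ge> 0" and risk: "\<And>m. K * real n \<le> real m \<Longrightarrow> passive_risk Ap f P m \<le> \<epsilon>" for n \<epsilon>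
  proof -
    have n3: "n \<ge> 3" "n div 2 \<ge> m0" using n by (auto simp: n0_def)
    have "max (1 / K) (32 * K) \<le> real n" using n unfolding n0_def by linarith
    then have nK: "1 / K \<le> real n" "32 * K \<le> real n" by auto
    have n_pos: "n > 0" using n3 by simp
    have n1: "1 \<le> K * real n" using nK(1) K by (simp add: field_simps)
    have n2: "4 / real n \<le> ?\<tau>" using nK(2) K n_pos by (simp add: field_simps)
    define k where "k = n div 2"
    define D where "D s = DIS (V k s)" for s
    have D: "D s \<in> sets P" for s unfolding D_def by (rule sets_DIS_V)
    define J where "J s = (\<integral>\<^sup>+v. ennreal (passive_risk Ap f P (tail_length (D s) n v))
        + emeasure Seq (crowded (D s) n (tail_length (D s) n v)) \<partial>Seq)" for s
    define E where "E = \<epsilon> + exp (- (1 / 16) * real n) + 2 * (exp (- (?\<tau> / 16) * real n) + exp (- (2 / 5) * real n))"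
    have E0: "0 \<le> E" using \<epsilon> unfolding E_def by (intro add_nonneg_nonneg) auto
    let ?A = "{s. ?\<tau> / 4 < prob (D s)}"
    have "{s \<in> space Seq. ?\<tau> / 4 < prob (D s)} \<in> sets Seq" unfolding D_def by measurable
    then have A[measurable]: "?A \<in> sets Seq" by simp
    have J: "J s \<le> ennreal E + 2 * indicator ?A s" for s
    proof (cases "s \<in> ?A")
      case True
      have "J s \<le> (\<integral>\<^sup>+v. 1 + 1 \<partial>Seq)"
        unfolding J_def by (intro nn_integral_mono add_mono passive_risk_le_1[OF Ap] Seq.emeasure_le_1)
      also have "\<dots> = 2" using Seq.emeasure_space_1 by (simp add: one_add_one)
      finally show ?thesis using True by (simp add: add_increasing)
    next
      case False
      then show ?thesis
        unfolding J_def E_def using estimation_bound[OF Ap D K n_pos n1 n2 _ \<epsilon> risk, of s] by simp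
    qed
    have "ennreal (active_risk (meta_algorithm_0 C pick Ap) f P n) =
      (\<integral>\<^sup>+s. \<integral>\<^sup>+w. \<integral>\<^sup>+v. meta_risk pick Ap n (comb_seq k s (comb_seq (n\<^sup>2 - k) w v)) \<partial>Seq \<partial>Seq \<partial>Seq)"
      by (rule active_risk_split[OF Ap pick])
    also have "\<dots> \<le> (\<integral>\<^sup>+s. \<integral>\<^sup>+w. \<integral>\<^sup>+v. sample_risk Ap (tail_length (D s) n v) w
        + indicator (crowded (D s) n (tail_length (D s) n v)) w \<partial>Seq \<partial>Seq \<partial>Seq)"
      unfolding D_def k_def crowded_def
      by (intro nn_integral_mono meta_risk_le[OF pick])
    also have "\<dots> = (\<integral>\<^sup>+s. J s \<partial>Seq)"
      unfolding J_def by (intro nn_integral_cong integrate_loop_points[OF Ap D])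
    also have "\<dots> \<le> (\<integral>\<^sup>+s. ennreal E + 2 * indicator ?A s \<partial>Seq)"
      by (intro nn_integral_mono J)
    also have "\<dots> = ennreal E + 2 * emeasure Seq ?A"
      using Seq.emeasure_space_1 A by (simp add: nn_integral_add nn_integral_cmult)
    also have "\<dots> \<le> ennreal E + 2 * ennreal (exp (- c * real k))"
      using m0[OF n3(2)] unfolding D_def k_def by (intro add_left_mono mult_left_mono) auto
    also have "\<dots> = ennreal (E + 2 * exp (- c * real k))"
      using E0 by (simp add: ennreal_mult)
    finally have "active_risk (meta_algorithm_0 C pick Ap) f P n \<le> E + 2 * exp (- c * real k)"
      using E0 by (subst (asm) ennreal_le_iff) auto
    also have "\<dots> \<le> \<epsilon> + 7 * exp (- c' * real n)"
    proof -
      have mono: "exp (- a * real n) \<le> exp (- c' * real n)" if "c' \<le> a" for a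
        using that by (simp add: mult_right_mono)
      have "real n / 3 \<le> real k" unfolding k_def using n3(1) by linarith
      then have "c / 3 * real n \<le> c * real k" using c by (simp add: mult_left_mono[of "real n / 3", simplified])
      then have "exp (- c * real k) \<le> exp (- (c / 3) * real n)" by simp
      also have "\<dots> \<le> exp (- c' * real n)" by (rule mono) (rule c')
      finally have "exp (- c * real k) \<le> exp (- c' * real n)" .
      moreover have "exp (- (1 / 16) * real n) \<le> exp (- c' * real n)"
        "exp (- (?\<tau> / 16) * real n) \<le> exp (- c' * real n)"
        "exp (- (2 / 5) * real n) \<le> exp (- c' * real n)"
        by (rule mono, use c'(2,3) in linarith)+
      ultimately show ?thesis unfolding E_def by argo
    qed
    finally show ?thesis .
  qed
  then show ?thesis using c'(1) by blast
qed

end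

subsection \<open>A passive algorithm that cannot be activized\<close>

text \<open>The risk on \<open>m > 0\<close> examples is \<open>1 / m\<close> when the target is \<open>f\<close>, whatever the labels it receives.\<close>

definition slow_learner :: "'a classifier \<Rightarrow> 'a passive_map" where
  "slow_learner f u L x \<longleftrightarrow> (if u * real (length L) \<le> 1 then \<not> f x else f x)"

lemma slow_learner_passive:
  assumes [measurable]: "f \<in> borel \<rightarrow>\<^sub>M count_space UNIV"
  shows "passive_algorithm (slow_learner f)"
  unfolding passive_algorithm_def slow_learner_def split_beta' by measurable

lemma seed_below: "emeasure seed {u. u * real m \<le> 1} = ennreal (if m = 0 then 1 else 1 / real m)"
proof -
  have "emeasure seed {u. u * real m \<le> 1} =
      emeasure lborel ({0..1} \<inter> {u::real. u * real m \<le> 1}) / emeasure lborel {0..1::real}"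
    unfolding seed_def by (rule emeasure_uniform_measure) auto
  also have "\<dots> = emeasure lborel {0..(if m = 0 then 1 else 1 / real m)}"
  proof -
    have "{0..1} \<inter> {u::real. u * real m \<le> 1} = {0..(if m = 0 then 1 else 1 / real m)}"
    proof (cases "m = 0")
      case False
      then have le: "1 / real m \<le> 1" by simp
      have eq: "u * real m \<le> 1 \<longleftrightarrow> u \<le> 1 / real m" for u :: real
        using False by (simp add: pos_le_divide_eq)
      have "u \<in> {0..1} \<inter> {u. u * real m \<le> 1} \<longleftrightarrow> u \<in> {0..1 / real m}" for u
        unfolding Int_iff mem_Collect_eq atLeastAtMost_iff eq using order_trans[OF _ le, of u] by blast
      then show ?thesis using False by (simp only: if_False set_eq_iff) blast
    qed auto
    moreover have "emeasure lborel {0..1::real} = 1" by simp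
    moreover have "x / 1 = x" for x :: ennreal by (simp add: divide_ennreal_def)
    ultimately show ?thesis by (simp only:)
  qed
  also have "\<dots> = ennreal (if m = 0 then 1 else 1 / real m)"
    by (subst emeasure_lborel_Icc) auto
  finally show ?thesis .
qed

lemma length_loop: "length (snd (foldl (loop_step D g n x y) (t, L) ms)) = length L + length ms"
proof (induction ms arbitrary: t L)
  case (Cons m ms)
  then show ?case by (cases "x m \<in> D \<and> t < n") (simp_all add: loop_step_def)
qed simp

context target_distribution
begin

text \<open>The error is 1 or 0 according to the seed alone, so the integral is the measure of the
  failing seeds. The sample may vary with the seed as long as its length does not.\<close>

lemma nn_integral_er_slow_learner:
  assumes "\<And>u. length (L u) = m"
  shows "(\<integral>\<^sup>+u. ennreal (er P f (slow_learner f u (L u))) \<partial>seed) = ennreal (if m = 0 then 1 else 1 / real m)"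
proof -
  have "ennreal (er P f (slow_learner f u (L u))) = indicator {u. u * real m \<le> 1} u" for u
    using prob_space by (simp add: er_def slow_learner_def assms indicator_def)
  moreover have "{u. u * real m \<le> 1} \<in> sets seed"
    unfolding sets_seed by measurable
  ultimately show ?thesis by (simp add: seed_below)
qed

lemma passive_risk_slow_learner:
  assumes "m > 0"
  shows "passive_risk (slow_learner f) f P m = 1 / real m"
proof -
  have "ennreal (passive_risk (slow_learner f) f P m) = ennreal (1 / real m)"
    unfolding passive_risk_eq(1)[OF slow_learner_passive[OF f_measurable]] sample_risk_def
    using Seq.emeasure_space_1 assms
    by (subst nn_integral_er_slow_learner[where m=m]) (simp_all add: true_sample_def)
  moreover have "0 \<le> passive_risk (slow_learner f) f P m"
    unfolding passive_risk_def by (rule integral_nonneg_AE) (simp add: er_nonneg split_beta')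
  ultimately show ?thesis
    by (subst (asm) ennreal_inj) auto
qed

section \<open>Lower bound on the active risk\<close>

lemma nn_integral_count:
  assumes D: "D \<in> sets P"
  shows "(\<integral>\<^sup>+v. ennreal (real (card {i. i < m \<and> v i \<in> D})) \<partial>Seq) = ennreal (real m * prob D)"
proof -
  have *: "(\<lambda>v. v i) \<in> Seq \<rightarrow>\<^sub>M P" for i by measurable
  have "emeasure Seq {v. v i \<in> D} = emeasure P D" for i
  proof -
    have "emeasure P D = emeasure (distr Seq P (\<lambda>s. s i)) D"
      using distr_PiM_component[of UNIV "\<lambda>_::nat. P" i] prob_space_axioms by simp
    also have "\<dots> = emeasure Seq {s. s i \<in> D}"
      by (subst emeasure_distr[OF * D]) (simp add: vimage_def)
    finally show ?thesis ..
  qed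
  moreover have "{v. v i \<in> D} \<in> sets Seq" for i
    using measurable_sets[OF * D] by (simp add: vimage_def)
  moreover have "ennreal (real (card {i. i < m \<and> v i \<in> D})) = (\<Sum>i<m. indicator {v. v i \<in> D} v)" for v
    by (simp add: indicator_def sum.If_cases lessThan_def Collect_conj_eq ennreal_of_nat_eq_real_of_nat)
  ultimately show ?thesis
    by (simp add: nn_integral_sum emeasure_eq_measure ennreal_mult ennreal_of_nat_eq_real_of_nat)
qed

text \<open>The length is at most \<open>real n / 4\<close> divided by the estimate, so its
  reciprocal is at least a multiple of the hit count over \<open>real n ^ 3\<close>; the multiple is
  rounded down to 1. The mean count is \<open>(real n)\<^sup>2 * prob (D s)\<close>, and
  \<open>prob_core_le\<close> bounds the mean of that probability.\<close>

lemma active_risk_lower: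
  assumes pick: "valid_choice_rule C pick" and n: "n > 0"
  shows "prob (disagreement_core C P f) / real n \<le> active_risk (meta_algorithm_0 C pick (slow_learner f)) f P n"
proof -
  define k where "k = n div 2"
  define D where "D s = DIS (V k s)" for s
  have D: "D s \<in> sets P" for s unfolding D_def by (rule sets_DIS_V)
  note Ap = slow_learner_passive[OF f_measurable]
  let ?x = "\<lambda>s w v. comb_seq k s (comb_seq (n\<^sup>2 - k) w v)"
  let ?cnt = "\<lambda>s v. real (card {i. i < n\<^sup>2 \<and> v i \<in> D s})"
  have low: "ennreal (1 / real n ^ 3) * ennreal (?cnt s v) \<le> meta_risk pick (slow_learner f) n (?x s w v)" for s w v
  proof -
    let ?N = "tail_length (D s) n v"
    have vs: "version_space C (initial_sample n (?x s w v) (\<lambda>i. f (?x s w v i))) = V k s"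
      unfolding version_space_initial_sample k_def V_comb_seq ..
    have len: "loop_length (DIS (V k s)) n (?x s w v) = ?N"
      unfolding k_def D_def loop_length_comb_seq ..
    have risk: "meta_risk pick (slow_learner f) n (?x s w v) = ennreal (if ?N = 0 then 1 else 1 / real ?N)"
      unfolding meta_risk_def run_meta_algorithm_0 Let_def vs len
      by (rule nn_integral_er_slow_learner) (simp add: length_loop k_def)
    have "?cnt s v \<le> real (card {..<n\<^sup>2})"
      by (intro of_nat_mono card_mono) auto
    then have c: "?cnt s v \<le> (real n)\<^sup>2" by simp
    have "1 / real n ^ 3 * ?cnt s v \<le> (if ?N = 0 then 1 else 1 / real ?N)"
    \<comment> \<open>On an empty sample the learner errs with certainty, and the count never
      exceeds \<open>(real n)\<^sup>2\<close>.\<close>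
    proof (cases "?N = 0")
      case True
      have "?cnt s v \<le> real n ^ 3"
        using c power_increasing[of 2 3 "real n"] n by linarith
      then show ?thesis using True n by (simp add: field_simps)
    next
      case False
      have pos: "0 < tail_estimate (D s) n v" using n by (simp add: tail_estimate_def less_max_iff_disj)
      have "real ?N \<le> real n / (4 * tail_estimate (D s) n v)"
        unfolding tail_length_def using pos by (intro of_nat_floor) simp
      then have "tail_estimate (D s) n v * real ?N \<le> real n / 4"
        using pos by (simp add: field_simps)
      moreover have "2 / (real n)\<^sup>2 * ?cnt s v * real ?N \<le> tail_estimate (D s) n v * real ?N"
        by (intro mult_right_mono) (auto simp: tail_estimate_def)
      ultimately have "2 / (real n)\<^sup>2 * ?cnt s v * real ?N \<le> real n" by linarith
      then have "2 * ?cnt s v * real ?N \<le> real n ^ 3"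
        using n by (simp add: field_simps power2_eq_square power3_eq_cube)
      moreover have "0 \<le> ?cnt s v * real ?N" by simp
      ultimately have "?cnt s v * real ?N \<le> real n ^ 3" by linarith
      then show ?thesis using False n by (simp add: field_simps)
    qed
    then show ?thesis
      unfolding risk by (subst ennreal_mult[symmetric]) (auto intro: ennreal_leI)
  qed
  have "ennreal (prob (disagreement_core C P f) / real n) = ennreal (1 / real n) * emeasure P (disagreement_core C P f)"
    by (simp add: emeasure_eq_measure ennreal_mult[symmetric])
  also have "\<dots> \<le> ennreal (1 / real n) * (\<integral>\<^sup>+s. emeasure P (D s) \<partial>Seq)"
    unfolding D_def by (intro mult_left_mono prob_core_le) simp
  also have "\<dots> = (\<integral>\<^sup>+s. ennreal (1 / real n) * emeasure P (D s) \<partial>Seq)"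
  proof (rule nn_integral_cmult[symmetric])
    show "(\<lambda>s. emeasure P (D s)) \<in> borel_measurable Seq"
      unfolding D_def emeasure_eq_measure by measurable
  qed
  also have "\<dots> = (\<integral>\<^sup>+s. \<integral>\<^sup>+w. \<integral>\<^sup>+v. ennreal (1 / real n ^ 3) * ennreal (?cnt s v) \<partial>Seq \<partial>Seq \<partial>Seq)"
  proof (intro nn_integral_cong)
    fix s
    have "(\<lambda>v. ennreal (?cnt s v)) \<in> borel_measurable Seq"
      using D[of s] by measurable
    then have "(\<integral>\<^sup>+w. \<integral>\<^sup>+v. ennreal (1 / real n ^ 3) * ennreal (?cnt s v) \<partial>Seq \<partial>Seq)
        = ennreal (1 / real n ^ 3) * ennreal (real (n\<^sup>2) * prob (D s))"
      using Seq.emeasure_space_1 by (simp add: nn_integral_cmult nn_integral_count[OF D])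
    also have "\<dots> = ennreal (1 / real n) * emeasure P (D s)"
      unfolding emeasure_eq_measure using n
      by (subst (1 2) ennreal_mult[symmetric]) (auto simp: power2_eq_square power3_eq_cube)
    finally show "ennreal (1 / real n) * emeasure P (D s) =
      (\<integral>\<^sup>+w. \<integral>\<^sup>+v. ennreal (1 / real n ^ 3) * ennreal (?cnt s v) \<partial>Seq \<partial>Seq)" ..
  qed
  also have "\<dots> \<le> (\<integral>\<^sup>+s. \<integral>\<^sup>+w. \<integral>\<^sup>+v. meta_risk pick (slow_learner f) n (?x s w v) \<partial>Seq \<partial>Seq \<partial>Seq)"
    by (intro nn_integral_mono low)
  also have "\<dots> = ennreal (active_risk (meta_algorithm_0 C pick (slow_learner f)) f P n)"
    by (rule active_risk_split[OF Ap pick, symmetric])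
  finally have "ennreal (prob (disagreement_core C P f) / real n)
      \<le> ennreal (active_risk (meta_algorithm_0 C pick (slow_learner f)) f P n)" .
  moreover have "0 \<le> active_risk (meta_algorithm_0 C pick (slow_learner f)) f P n"
    unfolding active_risk_def by (rule integral_nonneg_AE) (simp add: er_nonneg split_beta')
  ultimately show ?thesis
    by (subst (asm) ennreal_le_iff) auto
qed

end

subsection \<open>Label complexities\<close>

text \<open>The risk must stay below \<open>\<epsilon>\<close> from \<open>n0\<close> on, since it
  need not be monotone in \<open>n\<close>. If no such \<open>n0\<close> exists, the infimum of the
  empty set is \<open>\<infinity>\<close>.\<close>

definition least_label_complexity ::
  "('a classifier \<Rightarrow> 'a measure \<Rightarrow> nat \<Rightarrow> real) \<Rightarrow> 'a label_complexity" where
  "least_label_complexity risk \<epsilon> f P =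
     Inf {enat n0 |n0. 1 \<le> n0 \<and> (\<forall>n\<ge>n0. risk f P n \<le> \<epsilon>)}"

text \<open>Since \<open>enat\<close> is well-ordered, the infimum of a nonempty set of thresholds
  is itself a threshold.\<close>

lemma achieves_least_label_complexity: "achieves C risk (least_label_complexity risk)"
  unfolding achieves_def
proof (intro ballI allI impI conjI)
  fix f P and \<epsilon> :: real
  let ?A = "{enat n0 |n0. 1 \<le> n0 \<and> (\<forall>n\<ge>n0. risk f P n \<le> \<epsilon>)}"
  show "1 \<le> least_label_complexity risk \<epsilon> f P"
    unfolding least_label_complexity_def by (rule Inf_greatest) (auto simp: one_enat_def)
  fix n assume n: "least_label_complexity risk \<epsilon> f P \<le> enat n"
  have "?A \<noteq> {}"
  proof
    assume "?A = {}"
    then have "Inf ?A = \<infinity>" by (simp only: Inf_enat_def simp_thms if_True)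
    then show False using n by (simp only: least_label_complexity_def) simp
  qed
  then obtain a where "a \<in> ?A" by blast
  then have "Inf ?A \<in> ?A" by (rule wellorder_InfI)
  then obtain n0 where "Inf ?A = enat n0" "\<forall>n\<ge>n0. risk f P n \<le> \<epsilon>" by auto
  then show "risk f P n \<le> \<epsilon>"
    using n unfolding least_label_complexity_def by simp
qed

lemma least_label_complexity_le:
  assumes "1 \<le> n0" "\<And>n. n \<ge> n0 \<Longrightarrow> risk f P n \<le> \<epsilon>"
  shows "least_label_complexity risk \<epsilon> f P \<le> enat n0"
  unfolding least_label_complexity_def using assms by (intro Inf_lower) auto

section \<open>Complexity comparison for a null core\<close>

lemma ln_inverse_polylog: "(\<lambda>\<epsilon>. ln (1 / \<epsilon>)) \<in> polylog"
proof -
  have "(\<lambda>\<epsilon>::real. ln (1 / \<epsilon>)) \<in> O[at_right 0](\<lambda>\<epsilon>. ln (1 / \<epsilon>) powr 1)"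
    by real_asymp
  moreover have "0 \<le> ln (1 / \<epsilon>)" if "\<epsilon> \<in> {0<..<1::real}" for \<epsilon>
    using that by simp
  ultimately show ?thesis
    unfolding polylog_def by (intro CollectI conjI ballI exI[of _ 1]) auto
qed

lemma nontrivial_dominates_ln:
  assumes "(f, P) \<in> nontrivial \<Lambda>" "M > 0"
  shows "\<forall>\<^sub>F \<epsilon> in at_right 0. M * ln (1 / \<epsilon>) \<le> real (the_enat (\<Lambda> \<epsilon> f P))"
proof -
  have "(\<lambda>\<epsilon>. real (the_enat (\<Lambda> \<epsilon> f P))) \<in> \<omega>[at_right 0](\<lambda>\<epsilon>. ln (1 / \<epsilon>))"
    using assms(1) ln_inverse_polylog unfolding nontrivial_def by simp
  from landau_omega.smallD[OF this assms(2)] show ?thesis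
    by eventually_elim (simp, meson abs_ge_self mult_left_mono order_trans assms(2) less_imp_le)
qed

lemma eventually_at_right_0_less:
  assumes "(b::real) > 0"
  shows "\<forall>\<^sub>F \<epsilon> in at_right 0. 0 < \<epsilon> \<and> \<epsilon> < b"
  using eventually_at_right_real[OF assms] by eventually_elim simp

context target_distribution
begin

text \<open>About \<open>\<Lambda> \<epsilon> f P / K\<close> active labels already supply
  \<open>\<Lambda> \<epsilon> f P\<close> examples to the passive learner, enough for risk
  \<open>\<epsilon>\<close>. Superlogarithmic growth makes the exponential failure term at most
  another \<open>\<epsilon>\<close>.\<close>

lemma least_label_complexity_meta:
  assumes Ap: "passive_algorithm Ap" and pick: "valid_choice_rule C pick"
    and core: "prob (disagreement_core C P f) = 0"
    and \<Lambda>: "achieves C (passive_risk Ap) \<Lambda>" and nt: "(f, P) \<in> nontrivial \<Lambda>" and \<delta>: "\<delta> > 0"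
  defines "\<Lambda>a \<equiv> least_label_complexity (active_risk (meta_algorithm_0 C pick Ap))"
  shows "\<forall>\<^sub>F \<epsilon> in at_right 0. \<Lambda>a (2 * \<epsilon>) f P < \<infinity> \<and>
    real (the_enat (\<Lambda>a (2 * \<epsilon>) f P)) \<le> \<delta> * real (the_enat (\<Lambda> \<epsilon> f P))"
proof -
  \<comment> \<open>Rounding \<open>?L / K\<close> up at most doubles it, so
    \<open>K = 2 / \<delta>\<close> yields the factor \<open>\<delta>\<close>.\<close>
  define K where "K = 2 / \<delta>"
  have K: "K > 0" using \<delta> by (simp add: K_def)
  obtain c n0 where c: "c > 0" and risk: "\<And>n \<epsilon>. n \<ge> n0 \<Longrightarrow> 0 \<le> \<epsilon> \<Longrightarrow>
      (\<And>m. K * real n \<le> real m \<Longrightarrow> passive_risk Ap f P m \<le> \<epsilon>) \<Longrightarrow>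
      active_risk (meta_algorithm_0 C pick Ap) f P n \<le> \<epsilon> + 7 * exp (- c * real n)"
    using active_risk_upper[OF Ap pick core K] by metis
  \<comment> \<open>The three entries of the maxima ensure in turn that \<open>n\<close> reaches
    \<open>n0\<close>, that \<open>?L / K\<close> is at least 1, and that \<open>c * real n\<close>
    is at least \<open>2 * ln (1 / \<epsilon>)\<close>.\<close>
  define M where "M = K * max (real n0) (max 1 (2 / c))"
  have "M > 0" using K by (simp add: M_def less_max_iff_disj)
  then have "\<forall>\<^sub>F \<epsilon> in at_right 0. M * ln (1 / \<epsilon>) \<le> real (the_enat (\<Lambda> \<epsilon> f P))"
    by (rule nontrivial_dominates_ln[OF nt])
  moreover have "\<forall>\<^sub>F \<epsilon> in at_right 0. 0 < \<epsilon> \<and> \<epsilon> < (1 / 7 :: real)"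
    by (rule eventually_at_right_0_less) simp
  \<comment> \<open>Below \<open>1 / 7\<close>, \<open>ln (1 / \<epsilon>)\<close> is at least
    \<open>ln 7\<close>. One of its two copies in the exponent absorbs the factor 7, the other
    produces \<open>\<epsilon>\<close>.\<close>
  ultimately show ?thesis
  proof eventually_elim
    case (elim \<epsilon>)
    let ?L = "real (the_enat (\<Lambda> \<epsilon> f P))"
    have \<epsilon>: "0 < \<epsilon>" "\<epsilon> < 1 / 7" using elim by auto
    define l where "l = ln (1 / \<epsilon>)"
    have "7 < 1 / \<epsilon>" using \<epsilon> by (simp add: field_simps)
    then have l7: "ln 7 \<le> l" unfolding l_def by (intro ln_mono) auto
    have "exp 1 \<le> (7::real)" using exp_le by linarith
    then have "1 \<le> ln (7::real)" by (subst ln_ge_iff) auto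
    then have l1: "1 \<le> l" using l7 by simp
    have M_le: "M \<le> M * l" using l1 \<open>M > 0\<close> by simp
    have "K * (2 / c) * l \<le> M * l"
      using K l1 unfolding M_def by (intro mult_right_mono mult_left_mono) auto
    then have L: "K * real n0 \<le> ?L" "K \<le> ?L" "K * (2 / c) * l \<le> ?L"
      using elim(1) M_le K unfolding l_def[symmetric] by (auto simp: M_def max_mult_distrib_left)
    have fin: "\<Lambda> \<epsilon> f P = enat (the_enat (\<Lambda> \<epsilon> f P))"
    proof -
      have "\<Lambda> \<epsilon> f P < \<infinity>" using nt \<epsilon> unfolding nontrivial_def by auto
      then show ?thesis by auto
    qed
    define N where "N = nat \<lceil>?L / K\<rceil>"
    have N: "?L \<le> K * real N"
    proof -
      have "?L / K \<le> real N" unfolding N_def by (rule real_nat_ceiling_ge)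
      then show ?thesis using K by (simp add: pos_divide_le_eq mult.commute)
    qed
    have "active_risk (meta_algorithm_0 C pick Ap) f P n \<le> 2 * \<epsilon>" if n: "n \<ge> N" for n
    proof -
      have Ln: "?L \<le> K * real n" using N n K by (meson mult_left_mono less_imp_le of_nat_mono order_trans)
      have "K * real n0 \<le> K * real n" using L(1) Ln by linarith
      then have "n \<ge> n0" using K by simp
      have "passive_risk Ap f P m \<le> \<epsilon>" if "K * real n \<le> real m" for m
      proof -
        have "?L \<le> real m" using that Ln by linarith
        then have "\<Lambda> \<epsilon> f P \<le> enat m" by (subst fin) simp
        then show ?thesis using \<Lambda> f distr \<epsilon> unfolding achieves_def by auto
      qed
      then have "active_risk (meta_algorithm_0 C pick Ap) f P n \<le> \<epsilon> + 7 * exp (- c * real n)"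
        using \<open>n \<ge> n0\<close> \<epsilon> by (intro risk) auto
      also have "7 * exp (- c * real n) \<le> \<epsilon>"
      proof -
        have "K * (2 / c) * l \<le> K * real n" using L(3) Ln by linarith
        then have "2 / c * l \<le> real n" using K unfolding mult.assoc by (subst (asm) mult_le_cancel_left_pos)
        then have "2 * l \<le> c * real n" using c by (simp add: field_simps)
        then have "ln 7 + l \<le> c * real n" using l7 by linarith
        then have "exp (- c * real n) \<le> exp (- (ln 7 + l))" by simp
        also have "\<dots> = \<epsilon> / 7"
          using \<epsilon> by (simp add: l_def exp_minus exp_add exp_diff ln_div field_simps)
        finally show ?thesis by simp
      qed
      finally show ?thesis by simp
    qed
    moreover have "N \<ge> 1"
    proof -
      have "1 \<le> ?L / K" using L(2) K by simp
      then show ?thesis unfolding N_def by linarith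
    qed
    ultimately have le: "\<Lambda>a (2 * \<epsilon>) f P \<le> enat N"
      unfolding \<Lambda>a_def by (intro least_label_complexity_le)
    then obtain a where a: "\<Lambda>a (2 * \<epsilon>) f P = enat a" "a \<le> N"
      by (cases "\<Lambda>a (2 * \<epsilon>) f P") auto
    have "real N \<le> ?L / K + 1"
    proof -
      have "0 \<le> ?L / K" using K by simp
      then show ?thesis unfolding N_def by linarith
    qed
    also have "\<dots> \<le> ?L / K + ?L / K" using L(2) K by (intro add_left_mono) (simp add: pos_le_divide_eq)
    also have "\<dots> = \<delta> * ?L" using \<delta> by (simp add: K_def)
    finally show ?case using a by simp
  qed
qed

end

text \<open>One \<open>\<Lambda>a\<close> must serve all targets and distributions, and the least
  complexity does. The rates behind it depend on the pair, but the constant is always 2.\<close>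

lemma meta_algorithm_0_activizes:
  assumes vc: "vc_class C" and meas: "measurable_class C" and pick: "valid_choice_rule C pick"
    and core: "\<And>f P. f \<in> C \<Longrightarrow> distribution P \<Longrightarrow> measure P (disagreement_core C P f) = 0"
    and Ap: "passive_algorithm Ap"
  shows "activizes (meta_algorithm_0 C pick) Ap C"
  unfolding activizes_def
proof (intro allI impI)
  fix \<Lambda> assume \<Lambda>: "achieves C (passive_risk Ap) \<Lambda>"
  let ?\<Lambda>a = "least_label_complexity (active_risk (meta_algorithm_0 C pick Ap))"
  have "\<exists>c\<ge>1. (\<forall>\<^sub>F \<epsilon> in at_right 0. ?\<Lambda>a (c * \<epsilon>) f P < \<infinity>) \<and>
      (\<lambda>\<epsilon>. real (the_enat (?\<Lambda>a (c * \<epsilon>) f P))) \<in> o[at_right 0](\<lambda>\<epsilon>. real (the_enat (\<Lambda> \<epsilon> f P)))"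
    if f: "f \<in> C" and P: "distribution P" and nt: "(f, P) \<in> nontrivial \<Lambda>" for f P
  proof -
    interpret target_distribution C P f
      by (rule target_distribution.intro[OF vc meas P f])
    note ev = least_label_complexity_meta[OF Ap pick core[OF f P] \<Lambda> nt]
    have "(\<lambda>\<epsilon>. real (the_enat (?\<Lambda>a (2 * \<epsilon>) f P))) \<in> o[at_right 0](\<lambda>\<epsilon>. real (the_enat (\<Lambda> \<epsilon> f P)))"
    proof (rule landau_o.smallI)
      fix \<delta> :: real assume "\<delta> > 0"
      from ev[OF this] show "\<forall>\<^sub>F \<epsilon> in at_right 0. norm (real (the_enat (?\<Lambda>a (2 * \<epsilon>) f P))) \<le> \<delta> * norm (real (the_enat (\<Lambda> \<epsilon> f P)))"
        by eventually_elim simp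
    qed
    moreover have "\<forall>\<^sub>F \<epsilon> in at_right 0. ?\<Lambda>a (2 * \<epsilon>) f P < \<infinity>"
      using ev[of 1] by (auto elim: eventually_mono)
    ultimately show ?thesis by (intro exI[of _ 2]) auto
  qed
  then show "\<exists>\<Lambda>a. achieves C (active_risk (meta_algorithm_0 C pick Ap)) \<Lambda>a \<and>
      (\<forall>f\<in>C. \<forall>P. distribution P \<longrightarrow> (f, P) \<in> nontrivial \<Lambda> \<longrightarrow>
        (\<exists>c\<ge>1. (\<forall>\<^sub>F \<epsilon> in at_right 0. \<Lambda>a (c * \<epsilon>) f P < \<infinity>) \<and>
          (\<lambda>\<epsilon>. real (the_enat (\<Lambda>a (c * \<epsilon>) f P))) \<in> o[at_right 0](\<lambda>\<epsilon>. real (the_enat (\<Lambda> \<epsilon> f P)))))"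
    by (intro exI[of _ ?\<Lambda>a] conjI achieves_least_label_complexity) auto
qed

section \<open>Necessity of a null core\<close>

context target_distribution
begin

text \<open>The learner is tuned to \<open>f\<close>, so nothing is promised elsewhere: the value
  \<open>\<infinity>\<close> makes the requirement vacuous at all other pairs.\<close>

definition slow_complexity :: "'a label_complexity" where
  "slow_complexity \<epsilon> g Q = (if g = f \<and> Q = P then enat (nat \<lceil>1 / \<epsilon>\<rceil>) else \<infinity>)"

lemma achieves_slow_complexity: "achieves C (passive_risk (slow_learner f)) slow_complexity"
  unfolding achieves_def
proof (intro ballI allI impI conjI)
  fix g Q and \<epsilon> :: real assume \<epsilon>: "\<epsilon> \<in> {0<..<1}"
  then have "1 < 1 / \<epsilon>" by simp
  then have ge1: "1 \<le> nat \<lceil>1 / \<epsilon>\<rceil>" by linarith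
  then show "1 \<le> slow_complexity \<epsilon> g Q"
    by (simp add: slow_complexity_def one_enat_def)
  fix n assume n: "slow_complexity \<epsilon> g Q \<le> enat n"
  then have gQ: "g = f" "Q = P" and "nat \<lceil>1 / \<epsilon>\<rceil> \<le> n"
    by (auto simp: slow_complexity_def split: if_splits)
  then have "n > 0" "1 / \<epsilon> \<le> real n" using ge1 by linarith+
  then have "1 / real n \<le> \<epsilon>" using \<epsilon> by (simp add: field_simps)
  then show "passive_risk (slow_learner f) g Q n \<le> \<epsilon>"
    using \<open>n > 0\<close> by (simp add: gQ passive_risk_slow_learner)
qed

lemma nontrivial_slow_complexity: "(f, P) \<in> nontrivial slow_complexity"
  unfolding nontrivial_def mem_Collect_eq split_conv
proof (intro conjI ballI)
  fix g assume "g \<in> polylog"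
  then obtain k where "g \<in> O[at_right 0](\<lambda>\<epsilon>. ln (1 / \<epsilon>) powr k)"
    unfolding polylog_def by blast
  also have "(\<lambda>\<epsilon>::real. ln (1 / \<epsilon>) powr k) \<in> o[at_right 0](\<lambda>\<epsilon>. 1 / \<epsilon>)"
    by real_asymp
  also have "(\<lambda>\<epsilon>::real. 1 / \<epsilon>) \<in> O[at_right 0](\<lambda>\<epsilon>. real (the_enat (slow_complexity \<epsilon> f P)))"
  proof (rule landau_o.bigI[of 1])
    show "\<forall>\<^sub>F \<epsilon> in at_right 0. norm (1 / \<epsilon> :: real) \<le> 1 * norm (real (the_enat (slow_complexity \<epsilon> f P)))"
      using eventually_at_right_0_less[OF zero_less_one]
    proof eventually_elim
      case (elim \<epsilon>)
      have "the_enat (slow_complexity \<epsilon> f P) = nat \<lceil>1 / \<epsilon>\<rceil>" by (simp add: slow_complexity_def)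
      moreover have "norm (1 / \<epsilon>) = 1 / \<epsilon>" using elim by simp
      ultimately show ?case
        using real_nat_ceiling_ge[of "1 / \<epsilon>"] by (simp only: real_norm_def abs_of_nat mult_1)
    qed
  qed simp
  finally show "(\<lambda>\<epsilon>. real (the_enat (slow_complexity \<epsilon> f P))) \<in> \<omega>[at_right 0](g)"
    by (simp add: smallomega_iff_smallo)
qed (simp add: slow_complexity_def)

lemma core_null_if_activizes:
  assumes pick: "valid_choice_rule C pick"
    and act: "activizes (meta_algorithm_0 C pick) (slow_learner f) C"
  shows "prob (disagreement_core C P f) = 0"
proof (rule ccontr)
  define p where "p = prob (disagreement_core C P f)"
  assume "prob (disagreement_core C P f) \<noteq> 0"
  then have p: "p > 0" by (simp add: p_def zero_less_measure_iff)
  have "\<exists>\<Lambda>a. achieves C (active_risk (meta_algorithm_0 C pick (slow_learner f))) \<Lambda>a \<and>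
      (\<exists>c\<ge>1. (\<forall>\<^sub>F \<epsilon> in at_right 0. \<Lambda>a (c * \<epsilon>) f P < \<infinity>) \<and>
        (\<lambda>\<epsilon>. real (the_enat (\<Lambda>a (c * \<epsilon>) f P)))
          \<in> o[at_right 0](\<lambda>\<epsilon>. real (the_enat (slow_complexity \<epsilon> f P))))"
    using act f distr achieves_slow_complexity nontrivial_slow_complexity
    unfolding activizes_def by blast
  then obtain \<Lambda>a c where ach: "achieves C (active_risk (meta_algorithm_0 C pick (slow_learner f))) \<Lambda>a"
    and c: "c \<ge> 1" and fin: "\<forall>\<^sub>F \<epsilon> in at_right 0. \<Lambda>a (c * \<epsilon>) f P < \<infinity>"
    and small: "(\<lambda>\<epsilon>. real (the_enat (\<Lambda>a (c * \<epsilon>) f P)))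
          \<in> o[at_right 0](\<lambda>\<epsilon>. real (the_enat (slow_complexity \<epsilon> f P)))"
    by blast
  \<comment> \<open>Chosen so that the little-o bound gives at most
    \<open>\<delta> * (2 / \<epsilon>)\<close>, half of the lower bound
    \<open>p / (c * \<epsilon>)\<close>.\<close>
  define \<delta> where "\<delta> = p / (4 * c)"
  have \<delta>: "\<delta> > 0" using p c by (simp add: \<delta>_def)
  have "1 / c > 0" using c by simp
  \<comment> \<open>The restriction to \<open>\<epsilon> < 1 / c\<close> puts
    \<open>c * \<epsilon>\<close> into the range \<open>{0<..<1}\<close> covered by
    \<open>achieves\<close>.\<close>
  note eventually_at_right_0_less[OF this]
  with fin landau_o.smallD[OF small \<delta>] have "\<forall>\<^sub>F \<epsilon> in at_right (0::real). False"
  proof eventually_elim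
    case (elim \<epsilon>)
    then have \<epsilon>: "0 < \<epsilon>" "c * \<epsilon> < 1" using c by (auto simp: field_simps)
    have "\<epsilon> \<le> c * \<epsilon>" using c \<epsilon> by simp
    then have \<epsilon>1: "\<epsilon> < 1" using \<epsilon> by linarith
    \<comment> \<open>Eventual finiteness is essential here: at \<open>\<infinity>\<close> the value
      of \<open>the_enat\<close> carries no information.\<close>
    obtain n where n: "\<Lambda>a (c * \<epsilon>) f P = enat n" using elim(1) by auto
    have c\<epsilon>: "c * \<epsilon> \<in> {0<..<1}" using \<epsilon> c by simp
    then have "1 \<le> enat n" and risk: "active_risk (meta_algorithm_0 C pick (slow_learner f)) f P n \<le> c * \<epsilon>"
      using ach f distr n unfolding achieves_def by (metis order_refl)+
    then have n0: "n > 0" by (simp add: one_enat_def)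
    have "p / real n \<le> c * \<epsilon>"
      using active_risk_lower[OF pick n0] risk unfolding p_def by linarith
    then have lower: "p / (c * \<epsilon>) \<le> real n"
      using n0 \<epsilon> c by (simp add: field_simps)
    have "real n \<le> \<delta> * real (nat \<lceil>1 / \<epsilon>\<rceil>)"
      using elim(2) by (simp add: n slow_complexity_def)
    also have "real (nat \<lceil>1 / \<epsilon>\<rceil>) \<le> 2 / \<epsilon>"
    proof -
      have "1 < 1 / \<epsilon>" using \<epsilon> \<epsilon>1 by simp
      then have "real (nat \<lceil>1 / \<epsilon>\<rceil>) \<le> 1 / \<epsilon> + 1 / \<epsilon>" by linarith
      then show ?thesis by simp
    qed
    also have "\<delta> * (2 / \<epsilon>) = p / (c * \<epsilon>) / 2" by (simp add: \<delta>_def)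
    finally have "real n \<le> p / (c * \<epsilon>) / 2" using \<delta> by simp
    moreover have "0 < p / (c * \<epsilon>)" using p c \<epsilon> by simp
    moreover have "q / 2 < q" if "0 < q" for q :: real using that by simp
    ultimately show False using lower by (meson not_le order_trans)
  qed
  then show False by simp
qed

end

theorem theorem5:
  fixes C :: "'a::polish_space classifier set" and pick :: "'a choice_rule"
  assumes "vc_class C"
    and "measurable_class C"
    and "valid_choice_rule C pick"
  shows "universal_activizer (meta_algorithm_0 C pick) C \<longleftrightarrow>
         (\<forall>f\<in>C. \<forall>P. distribution P \<longrightarrow> measure P (disagreement_core C P f) = 0)"
proof
  assume act: "universal_activizer (meta_algorithm_0 C pick) C"
  show "\<forall>f\<in>C. \<forall>P. distribution P \<longrightarrow> measure P (disagreement_core C P f) = 0"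
  proof (intro ballI allI impI)
    fix f and P :: "'a measure" assume "f \<in> C" "distribution P"
    then interpret target_distribution C P f
      by (intro target_distribution.intro assms)
    have "activizes (meta_algorithm_0 C pick) (slow_learner f) C"
      using act slow_learner_passive[OF f_measurable] unfolding universal_activizer_def by blast
    then show "measure P (disagreement_core C P f) = 0"
      by (rule core_null_if_activizes[OF assms(3)])
  qed
next
  assume "\<forall>f\<in>C. \<forall>P. distribution P \<longrightarrow> measure P (disagreement_core C P f) = 0"
  then show "universal_activizer (meta_algorithm_0 C pick) C"
    unfolding universal_activizer_def
    by (intro conjI active_meta_algorithm_0 allI impI meta_algorithm_0_activizes assms) auto
qed

end
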